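(* Let $A$ and $B$ be uniform algebras on compact Hausdorff spaces $\Omega_1$, $\Omega_2$ respectively, and let $f_1$, $f_2$ be strictly positive continuous functions on $\Omega_1$, $\Omega_2$ respectively. Suppose there is a surjective linear isometry $T : Af_1 \to Bf_2$. Then there are an invertible element $h$ of $B$ and a homeomorphism $\varphi$ of $\Omega_2$ onto a subset $\varphi(\Omega_2)$ of $M_A$ such that (i) the map $a \mapsto a\circ\varphi$ is an isometric isomorphism of $A$ onto $B$; (ii) $\varphi(\partial B) = \partial A$; (iii) $\varphi(\partial(Bf_2)) \subset \Omega_1$ and $\dfrac{f_1\circ\varphi}{f_2} = |h|$ on $\partial(Bf_2)$; and $$T(af_1) = (a\circ\varphi)\, h\, f_2 \quad \text{on } \Omega_2, \text{ for all } a\in A .$$ Moreover, if $A = B$, then $T$ is an $A$-module isometry if and only if $\varphi$ is equal to the identity map (i.e. $\varphi(x)$ is evaluation at $x$ for every $x \in \Omega_2$).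
   Context: A uniform algebra (function algebra) on a compact Hausdorff space $\Omega$ is a closed subalgebra of $C(\Omega)$ (complex continuous functions, sup norm) which contains the constants and separates points. $M_A$ is the maximal ideal space of $A$; elements of $A$ are identified with their Gelfand transforms, so $a\circ\varphi$ means $\hat a\circ\varphi$. Via point evaluations $\Omega$ is regarded as a subset of $M_A$. For strictly positive $f\in C(\Omega)$, $Af = \{af : a\in A\}\subset C(\Omega)$ with the sup norm; it is an $A$-module under multiplication. For a linear subspace $E$ of $C(\Omega)$, the Choquet boundary is $Ch(E)=\{x\in\Omega : \text{evaluation at } x \text{ is an extreme point of the closed unit ball of } E^*\}$, and the Shilov boundary $\partial E$ is the closure of $Ch(E)$ in $\Omega$. The Shilov boundaries $\partial A$, $\partial B$ are regarded as subsets of $M_A$ and $\Omega_2$ respectively. *)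

theory Defs
  imports "HOL-Analysis.Analysis"
begin

text \<open>
  A space is a topology on a carrier set, and a function on it is extensional
  (equal to \<open>undefined\<close> off \<^term>\<open>topspace X\<close>), so that equality of functions means equality on
  the space. The sup metric on \<open>C(X)\<close> is the library's \<^const>\<open>cfunspace\<close>.
  Two spaces over one type may have arbitrary, for instance disjoint, carriers, so considering
  them over a common type is no restriction, and it lets algebras on them be compared by equality.
\<close>

abbreviation sup_metric :: "'a topology \<Rightarrow> ('a \<Rightarrow> complex) metric" where
  "sup_metric X \<equiv> cfunspace X euclidean_metric"

definition cfuns :: "'a topology \<Rightarrow> ('a \<Rightarrow> complex) set" where
  "cfuns X = {f \<in> extensional (topspace X). continuous_map X euclidean f}"

definition fconst :: "'a topology \<Rightarrow> complex \<Rightarrow> 'a \<Rightarrow> complex" where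
  "fconst X c = (\<lambda>x\<in>topspace X. c)"

definition fadd :: "'a topology \<Rightarrow> ('a \<Rightarrow> complex) \<Rightarrow> ('a \<Rightarrow> complex) \<Rightarrow> 'a \<Rightarrow> complex" where
  "fadd X f g = (\<lambda>x\<in>topspace X. f x + g x)"

definition fmult :: "'a topology \<Rightarrow> ('a \<Rightarrow> complex) \<Rightarrow> ('a \<Rightarrow> complex) \<Rightarrow> 'a \<Rightarrow> complex" where
  "fmult X f g = (\<lambda>x\<in>topspace X. f x * g x)"

definition fscale :: "'a topology \<Rightarrow> complex \<Rightarrow> ('a \<Rightarrow> complex) \<Rightarrow> 'a \<Rightarrow> complex" where
  "fscale X c f = (\<lambda>x\<in>topspace X. c * f x)"

definition supnorm :: "'a topology \<Rightarrow> ('a \<Rightarrow> complex) \<Rightarrow> real" where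
  "supnorm X f = mdist (sup_metric X) f (fconst X 0)"

lemma mspace_sup_metric:
  assumes "compact_space X"
  shows "mspace (sup_metric X) = cfuns X"
proof -
  have "Metric_space.mbounded UNIV dist (f ` topspace X)"
    if "continuous_map X euclidean f" for f :: "'a \<Rightarrow> complex"
  proof -
    have "compactin euclidean (f ` topspace X)"
      using assms that by (metis compact_space_def image_compactin)
    then have "bounded (f ` topspace X)"
      by (simp add: compact_imp_bounded)
    then show ?thesis
      by (simp add: bounded_def Met_TC.mbounded_alt)
  qed
  then show ?thesis
    by (auto simp: cfuns_def)
qed

lemma supnorm_eq_SUP:
  assumes "compact_space X" "topspace X \<noteq> {}" "f \<in> cfuns X"
  shows "supnorm X f = (SUP x\<in>topspace X. norm (f x))"
proof -
  have "fconst X 0 \<in> cfuns X"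
    unfolding cfuns_def fconst_def
    by (simp add: continuous_map_eq[where f = "\<lambda>_. 0"])
  then have "f \<in> Met_TC.fspace (topspace X)" "fconst X 0 \<in> Met_TC.fspace (topspace X)"
    using assms mspace_sup_metric[OF assms(1)]
    by (auto simp: cfunspace_def)
  then show ?thesis
    using assms(2)
    by (auto simp: supnorm_def mdist_cfunspace_eq_mdist_funspace Met_TC.fdist_def
        fconst_def intro!: SUP_cong)
qed

definition uniform_algebra :: "'a topology \<Rightarrow> ('a \<Rightarrow> complex) set \<Rightarrow> bool" where
  "uniform_algebra X A \<longleftrightarrow>
     A \<subseteq> cfuns X \<and>
     closedin (mtopology_of (sup_metric X)) A \<and>
     (\<forall>a\<in>A. \<forall>b\<in>A. fadd X a b \<in> A) \<and>
     (\<forall>a\<in>A. \<forall>b\<in>A. fmult X a b \<in> A) \<and>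
     (\<forall>c. \<forall>a\<in>A. fscale X c a \<in> A) \<and>
     (\<forall>c. fconst X c \<in> A) \<and>
     (\<forall>x\<in>topspace X. \<forall>y\<in>topspace X. x \<noteq> y \<longrightarrow> (\<exists>a\<in>A. a x \<noteq> a y))"

definition invertible_in :: "'a topology \<Rightarrow> ('a \<Rightarrow> complex) set \<Rightarrow> ('a \<Rightarrow> complex) \<Rightarrow> bool" where
  "invertible_in X B h \<longleftrightarrow> h \<in> B \<and> (\<exists>k\<in>B. fmult X h k = fconst X 1)"

definition weighted :: "'a topology \<Rightarrow> ('a \<Rightarrow> real) \<Rightarrow> ('a \<Rightarrow> complex) \<Rightarrow> 'a \<Rightarrow> complex" where
  "weighted X f a = (\<lambda>x\<in>topspace X. a x * of_real (f x))"

definition weighted_space ::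
    "'a topology \<Rightarrow> ('a \<Rightarrow> complex) set \<Rightarrow> ('a \<Rightarrow> real) \<Rightarrow> ('a \<Rightarrow> complex) set" where
  "weighted_space X A f = weighted X f ` A"

definition linear_functional_on ::
    "'a topology \<Rightarrow> ('a \<Rightarrow> complex) set \<Rightarrow> (('a \<Rightarrow> complex) \<Rightarrow> complex) \<Rightarrow> bool" where
  "linear_functional_on X E L \<longleftrightarrow>
     (\<forall>f\<in>E. \<forall>g\<in>E. L (fadd X f g) = L f + L g) \<and>
     (\<forall>c. \<forall>f\<in>E. L (fscale X c f) = c * L f)"

text \<open>Functionals on \<open>E\<close> are extensional too, so equality in the dual is equality on \<open>E\<close>.\<close>

definition dual_unit_ball ::
    "'a topology \<Rightarrow> ('a \<Rightarrow> complex) set \<Rightarrow> (('a \<Rightarrow> complex) \<Rightarrow> complex) set" where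
  "dual_unit_ball X E =
     {L \<in> extensional E. linear_functional_on X E L \<and> (\<forall>f\<in>E. norm (L f) \<le> supnorm X f)}"

definition dual_ball_extreme_points ::
    "'a topology \<Rightarrow> ('a \<Rightarrow> complex) set \<Rightarrow> (('a \<Rightarrow> complex) \<Rightarrow> complex) set" where
  "dual_ball_extreme_points X E =
     {L \<in> dual_unit_ball X E.
        \<forall>L1\<in>dual_unit_ball X E. \<forall>L2\<in>dual_unit_ball X E. \<forall>t::real.
          0 < t \<and> t < 1 \<and> L = (\<lambda>f\<in>E. of_real (1 - t) * L1 f + of_real t * L2 f)
          \<longrightarrow> L1 = L2}"

definition point_eval :: "('a \<Rightarrow> complex) set \<Rightarrow> 'a \<Rightarrow> ('a \<Rightarrow> complex) \<Rightarrow> complex" where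
  "point_eval E x = (\<lambda>f\<in>E. f x)"

definition choquet_boundary :: "'a topology \<Rightarrow> ('a \<Rightarrow> complex) set \<Rightarrow> 'a set" where
  "choquet_boundary X E = {x \<in> topspace X. point_eval E x \<in> dual_ball_extreme_points X E}"

definition shilov_boundary :: "'a topology \<Rightarrow> ('a \<Rightarrow> complex) set \<Rightarrow> 'a set" where
  "shilov_boundary X E = X closure_of choquet_boundary X E"

text \<open>
  Maximal ideals are represented by the nonzero multiplicative linear functionals whose
  kernels they are. The Gelfand topology is pointwise convergence on \<open>A\<close>.
\<close>

definition characters ::
    "'a topology \<Rightarrow> ('a \<Rightarrow> complex) set \<Rightarrow> (('a \<Rightarrow> complex) \<Rightarrow> complex) set" where
  "characters X A =
     {m \<in> extensional A. linear_functional_on X A m \<and>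
        (\<forall>a\<in>A. \<forall>b\<in>A. m (fmult X a b) = m a * m b) \<and> (\<exists>a\<in>A. m a \<noteq> 0)}"

definition maximal_ideal_space ::
    "'a topology \<Rightarrow> ('a \<Rightarrow> complex) set \<Rightarrow> (('a \<Rightarrow> complex) \<Rightarrow> complex) topology" where
  "maximal_ideal_space X A =
     subtopology (product_topology (\<lambda>_. euclidean) A) (characters X A)"

definition gelfand :: "('a \<Rightarrow> complex) \<Rightarrow> (('a \<Rightarrow> complex) \<Rightarrow> complex) \<Rightarrow> complex" where
  "gelfand a m = m a"

definition linear_isometry_onto ::
    "'a topology \<Rightarrow> ('a \<Rightarrow> complex) set \<Rightarrow> 'b topology \<Rightarrow> ('b \<Rightarrow> complex) set \<Rightarrow>
     (('a \<Rightarrow> complex) \<Rightarrow> 'b \<Rightarrow> complex) \<Rightarrow> bool" where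
  "linear_isometry_onto X E Y F T \<longleftrightarrow>
     T ` E = F \<and>
     (\<forall>f\<in>E. \<forall>g\<in>E. T (fadd X f g) = fadd Y (T f) (T g)) \<and>
     (\<forall>c. \<forall>f\<in>E. T (fscale X c f) = fscale Y c (T f)) \<and>
     (\<forall>f\<in>E. supnorm Y (T f) = supnorm X f)"

definition isometric_algebra_iso ::
    "'a topology \<Rightarrow> ('a \<Rightarrow> complex) set \<Rightarrow> 'b topology \<Rightarrow> ('b \<Rightarrow> complex) set \<Rightarrow>
     (('a \<Rightarrow> complex) \<Rightarrow> 'b \<Rightarrow> complex) \<Rightarrow> bool" where
  "isometric_algebra_iso X A Y B S \<longleftrightarrow>
     linear_isometry_onto X A Y B S \<and> bij_betw S A B \<and>
     (\<forall>a\<in>A. \<forall>b\<in>A. S (fmult X a b) = fmult Y (S a) (S b))"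

definition module_isometry_onto ::
    "'a topology \<Rightarrow> ('a \<Rightarrow> complex) set \<Rightarrow> ('a \<Rightarrow> complex) set \<Rightarrow> ('a \<Rightarrow> complex) set \<Rightarrow>
     (('a \<Rightarrow> complex) \<Rightarrow> 'a \<Rightarrow> complex) \<Rightarrow> bool" where
  "module_isometry_onto X A E F T \<longleftrightarrow>
     linear_isometry_onto X E X F T \<and>
     (\<forall>a\<in>A. \<forall>g\<in>E. T (fmult X a g) = fmult X a (T g))"

end

theory Submission
  imports Defs
begin

text \<open>
  An extreme point of the dual ball of a nonvanishing space \<open>E\<close> of continuous functions on a compact
  space is a unimodular multiple of a point evaluation, and by the usual face argument there are
  enough of them for the Choquet boundary to determine the elements of \<open>E\<close>. The adjoint of \<open>T\<close>
  permutes extreme points, so \<open>S a = T (a f\<^sub>1) / f\<^sub>2\<close> has the form \<open>S a y = h y * a x\<close>, with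
  \<open>h = S 1\<close>, at every Choquet boundary point \<open>y\<close> of \<open>B f\<^sub>2\<close>. Hence \<open>S (a b) h = S a S b\<close> there, and so
  everywhere. If \<open>S g = 1\<close> this gives \<open>h S (g\<^sup>2) = 1\<close>, so \<open>h\<close> is invertible and \<open>U a = S a / h\<close> is
  an algebra isomorphism bounded in both directions; comparing norms of powers makes it isometric.
  Then \<open>\<phi> y\<close> is evaluation at \<open>y\<close> composed with \<open>U\<close>.
\<close>

subsection \<open>Compactness and separation in the dual\<close>

text \<open>That extreme points are multiples of evaluations is usually read off from representing
  measures. Here it rests on a splitting property: a functional dominated by the larger of the
  suprema over two compact sets is a sum of two functionals dominated on each of them, with weights
  adding up to one. Extremality rules out a genuine splitting, so one of the two sets carries the
  functional alone.

  Two obstacles shape the rest. The point \<open>x\<close> belonging to \<open>y\<close> is only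
  available on the Choquet boundary of the weighted space, which need not be that of
  \<open>B\<close>. The product identity does not mention \<open>x\<close>, so it is what can be
  carried to all of the second space; the price is that elsewhere \<open>\<phi> y\<close> is known
  only as a character. Moreover \<open>T\<close> preserves weighted norms, so at first
  \<open>U\<close> is controlled only up to constants that depend on the weights. Once it is
  isometric, the extreme-point argument can be run a second time on \<open>U\<close> itself, and
  this second run, not the first, matches the Choquet boundaries of \<open>A\<close> and
  \<open>B\<close>.\<close>

definition bounded_functionals ::
    "'a topology \<Rightarrow> ('a \<Rightarrow> complex) set \<Rightarrow> (('a \<Rightarrow> complex) \<Rightarrow> real) \<Rightarrow> (('a \<Rightarrow> complex) \<Rightarrow> complex) set" where
  "bounded_functionals X E p =
     {L \<in> extensional E. linear_functional_on X E L \<and> (\<forall>f\<in>E. norm (L f) \<le> p f)}"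

lemma dual_unit_ball_eq: "dual_unit_ball X E = bounded_functionals X E (supnorm X)"
  by (simp add: dual_unit_ball_def bounded_functionals_def)

lemma continuous_on_eval: "continuous_on S (\<lambda>L. L f)" for f :: 'a and S :: "('a \<Rightarrow> complex) set"
  by (rule continuous_on_subset[OF continuous_on_product_coordinates subset_UNIV])

lemma continuous_on_eval_pair:
  fixes S :: "(real \<times> ('a \<Rightarrow> complex) \<times> ('a \<Rightarrow> complex)) set"
  shows "continuous_on S (\<lambda>q. fst (snd q) f)" "continuous_on S (\<lambda>q. snd (snd q) f)"
  by (rule continuous_on_product_then_coordinatewise, intro continuous_intros)+

lemma closed_linear_functionals: "closed {L. linear_functional_on X E L}"
proof -
  have "{L. linear_functional_on X E L} =
    (\<Inter>f\<in>E. \<Inter>g\<in>E. {L. L (fadd X f g) = L f + L g}) \<inter> (\<Inter>c. \<Inter>f\<in>E. {L. L (fscale X c f) = c * L f})"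
    by (auto simp: linear_functional_on_def)
  moreover have "closed \<dots>"
    by (intro closed_Int closed_INT ballI closed_Collect_eq continuous_intros continuous_on_eval)
  ultimately show ?thesis by simp
qed

lemma closed_extensional: "closed (extensional E :: ('a \<Rightarrow> complex) set)"
proof -
  have "(extensional E :: ('a \<Rightarrow> complex) set) = (\<Inter>f\<in>-E. {L. L f = undefined})"
    by (auto simp: extensional_def)
  moreover have "closed \<dots>"
    by (intro closed_INT ballI closed_Collect_eq continuous_intros continuous_on_eval)
  ultimately show ?thesis by simp
qed

lemma bounded_functionals_eq:
  "bounded_functionals X E p =
     extensional E \<inter> {L. linear_functional_on X E L} \<inter> (\<Inter>f\<in>E. {L. norm (L f) \<le> p f})"
  by (auto simp: bounded_functionals_def)

lemma closed_bounded_functionals: "closed (bounded_functionals X E p)"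
  unfolding bounded_functionals_eq
  by (intro closed_Int closed_extensional closed_linear_functionals closed_INT ballI
      closed_Collect_le continuous_intros continuous_on_eval)

text \<open>Tychonoff, as in Banach-Alaoglu. The ambient product runs over all functions, so a
  coordinate outside \<open>E\<close> gets the one-point factor \<open>{undefined}\<close> forced by
  extensionality. The bound \<open>p\<close> will be the sup norm, or the maximum over a compact
  set, possibly times a weight.\<close>

lemma compact_bounded_functionals: "compact (bounded_functionals X E p)"
proof -
  have "compactin (product_topology (\<lambda>_. euclidean) UNIV)
     (PiE UNIV (\<lambda>f. if f \<in> E then cball (0::complex) (p f) else {undefined}))"
    by (subst compactin_PiE) auto
  then have "compact (PiE UNIV (\<lambda>f. if f \<in> E then cball (0::complex) (p f) else {undefined}))"
    by (simp add: euclidean_product_topology)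
  moreover have "bounded_functionals X E p =
     PiE UNIV (\<lambda>f. if f \<in> E then cball (0::complex) (p f) else {undefined}) \<inter> bounded_functionals X E p"
    by (auto simp: bounded_functionals_def PiE_def Pi_def extensional_def)
  ultimately show ?thesis
    by (metis closed_bounded_functionals compact_Int_closed)
qed

section \<open>Separation from compact convex sets and splitting of functionals\<close>

definition linear_space :: "'a topology \<Rightarrow> ('a \<Rightarrow> complex) set \<Rightarrow> bool" where
  "linear_space X E \<longleftrightarrow> E \<subseteq> cfuns X \<and> E \<noteq> {} \<and>
     (\<forall>f\<in>E. \<forall>g\<in>E. fadd X f g \<in> E) \<and> (\<forall>c. \<forall>f\<in>E. fscale X c f \<in> E)"

lemma linear_functional_on_comb:
  assumes "linear_functional_on X E L" "linear_functional_on X E M" "linear_space X E"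
  shows "linear_functional_on X E (\<lambda>f\<in>E. c * L f + d * M f)"
  using assms by (simp add: linear_functional_on_def linear_space_def algebra_simps)

lemma linear_functional_on_scale:
  assumes "linear_functional_on X E L" "linear_space X E"
  shows "linear_functional_on X E (\<lambda>f\<in>E. c * L f)"
  using assms by (simp add: linear_functional_on_def linear_space_def algebra_simps)

text \<open>Turns a linear form in finitely many values of a functional into its value at one
  element of \<open>E\<close>, and that element is the same for all functionals.\<close>

lemma linear_combination_in_space:
  assumes "linear_space X E" "finite F" "F \<subseteq> E"
  obtains g where "g \<in> E" "\<And>N. linear_functional_on X E N \<Longrightarrow> N g = (\<Sum>f\<in>F. c f * N f)"
proof -
  have "\<exists>g\<in>E. \<forall>N. linear_functional_on X E N \<longrightarrow> N g = (\<Sum>f\<in>F. c f * N f)"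
    using assms(2,3)
  proof (induction F rule: finite_induct)
    case empty
    obtain f where "f \<in> E" using assms(1) by (auto simp: linear_space_def)
    then show ?case
      using assms(1)
      by (intro bexI[of _ "fscale X 0 f"]) (auto simp: linear_space_def linear_functional_on_def)
  next
    case (insert f F)
    then obtain g where "g \<in> E" "\<forall>N. linear_functional_on X E N \<longrightarrow> N g = (\<Sum>f\<in>F. c f * N f)"
      by auto
    then show ?case
      using assms(1) insert
      by (intro bexI[of _ "fadd X (fscale X (c f) f) g"]) (auto simp: linear_space_def linear_functional_on_def)
  qed
  then show ?thesis using that by blast
qed

text \<open>
  Separation without Hahn--Banach: on finitely many coordinates the point of \<open>C\<close> nearest to \<open>L\<close>
  in the least squares sense agrees with \<open>L\<close>, by the first variation; compactness does the rest.
\<close>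

lemma mem_compact_convex_functionals:
  fixes C :: "(('a \<Rightarrow> complex) \<Rightarrow> complex) set"
  assumes E: "linear_space X E"
    and C: "compact C" "C \<noteq> {}" "C \<subseteq> extensional E" "\<And>M. M \<in> C \<Longrightarrow> linear_functional_on X E M"
    and conv: "\<And>M N t. M \<in> C \<Longrightarrow> N \<in> C \<Longrightarrow> 0 < t \<Longrightarrow> t < 1 \<Longrightarrow>
      (\<lambda>f\<in>E. of_real (1 - t) * M f + of_real t * N f) \<in> C"
    and L: "L \<in> extensional E" "linear_functional_on X E L"
    and dom: "\<And>f. f \<in> E \<Longrightarrow> \<exists>M\<in>C. Re (L f) \<le> Re (M f)"
  shows "L \<in> C"
proof -
  have fin: "\<exists>M\<in>C. \<forall>f\<in>F. M f = L f" if F: "finite F" "F \<subseteq> E" for F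
  proof -
    define D where "D M = (\<Sum>f\<in>F. (norm (M f - L f))\<^sup>2)" for M
    have "continuous_on C D"
      unfolding D_def by (intro continuous_intros continuous_on_eval)
    then obtain M where M: "M \<in> C" and min: "\<And>N. N \<in> C \<Longrightarrow> D M \<le> D N"
      using continuous_attains_inf[OF C(1,2)] by blast
    \<comment> \<open>\<open>g\<close> represents the gradient of \<open>D\<close> at
      \<open>M\<close>. The conjugated coefficients are chosen so that \<open>M g - L g\<close>
      equals \<open>D M\<close>.\<close>
    obtain g where g: "g \<in> E"
      "\<And>N. linear_functional_on X E N \<Longrightarrow> N g = (\<Sum>f\<in>F. cnj (M f - L f) * N f)"
      using linear_combination_in_space[OF E F, of "\<lambda>f. cnj (M f - L f)"] by blast
    \<comment> \<open>Domination at \<open>-g\<close> gives a point \<open>N\<close> of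
      \<open>C\<close> with \<open>Re (N g) \<le> Re (L g)\<close>. Moving \<open>M\<close> towards
      \<open>N\<close> changes \<open>D\<close> at the initial rate \<open>2 * r\<close>, which is
      at most \<open>-2 * D M\<close>, so minimality forces \<open>D M\<close> to vanish.\<close>
    have "fscale X (-1) g \<in> E" using E g(1) by (auto simp: linear_space_def)
    then obtain N where N: "N \<in> C" "Re (L (fscale X (-1) g)) \<le> Re (N (fscale X (-1) g))"
      using dom by blast
    then have NL: "Re (N g) \<le> Re (L g)"
      using C(4)[OF N(1)] L(2) g(1) by (simp add: linear_functional_on_def)
    define Q where "Q = (\<Sum>f\<in>F. (norm (N f - M f))\<^sup>2)"
    define r where "r = Re (N g - M g)"
    have r_eq: "r = (\<Sum>f\<in>F. Re (cnj (M f - L f) * (N f - M f)))"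
      using g(2)[OF C(4)[OF M]] g(2)[OF C(4)[OF N(1)]]
      by (simp add: r_def right_diff_distrib sum_subtractf del: complex_cnj_diff)
    have variation: "0 \<le> 2 * r + t * Q" if t: "0 < t" "t < 1" for t
    proof -
      have *: "(norm (a + of_real t * b))\<^sup>2 = (norm a)\<^sup>2 + t * (2 * Re (cnj a * b)) + t\<^sup>2 * (norm b)\<^sup>2" for a b :: complex
        unfolding cmod_power2 by (simp add: power2_eq_square algebra_simps)
      have "D M \<le> D (\<lambda>f\<in>E. of_real (1 - t) * M f + of_real t * N f)"
        using min conv[OF M N(1) t] by blast
      also have "\<dots> = (\<Sum>f\<in>F. (norm ((M f - L f) + of_real t * (N f - M f)))\<^sup>2)"
        unfolding D_def using F(2)
        by (intro sum.cong refl) (auto simp: algebra_simps)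
      also have "\<dots> = D M + t * (2 * r) + t\<^sup>2 * Q"
        by (simp only: * sum.distrib D_def Q_def r_eq sum_distrib_left)
      finally have "0 \<le> t * (2 * r + t * Q)"
        by (simp add: power2_eq_square algebra_simps)
      then show ?thesis using t by (simp add: zero_le_mult_iff)
    qed
    have "((\<lambda>t. 2 * r + t * Q) \<longlongrightarrow> 2 * r + 0 * Q) (at_right 0)"
      by (intro tendsto_intros)
    moreover have "\<forall>\<^sub>F t in at_right (0::real). 0 \<le> 2 * r + t * Q"
      using variation unfolding eventually_at_right_field by (intro exI[of _ 1]) auto
    ultimately have "0 \<le> 2 * r + 0 * Q"
      by (intro tendsto_lowerbound) auto
    moreover have "D M = Re (M g) - Re (L g)"
    proof -
      have "M g - L g = (\<Sum>f\<in>F. cnj (M f - L f) * (M f - L f))"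
        using g(2)[OF C(4)[OF M]] g(2)[OF L(2)]
        by (simp add: right_diff_distrib sum_subtractf del: complex_cnj_diff)
      also have "\<dots> = (\<Sum>f\<in>F. of_real ((norm (M f - L f))\<^sup>2))"
        by (intro sum.cong refl) (metis complex_norm_square mult.commute)
      also have "\<dots> = of_real (D M)" by (simp add: D_def)
      finally show ?thesis by (metis Re_complex_of_real minus_complex.sel(1))
    qed
    ultimately have "D M \<le> 0" using NL by (simp add: r_def)
    then have "\<forall>f\<in>F. (norm (M f - L f))\<^sup>2 = 0"
      unfolding D_def
      using sum_nonneg_eq_0_iff[OF F(1), of "\<lambda>f. (norm (M f - L f))\<^sup>2"] sum_nonneg[of F "\<lambda>f. (norm (M f - L f))\<^sup>2"]
      by (smt (verit) zero_le_power2)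
    then show ?thesis using M by auto
  qed
  have "C \<inter> (\<Inter>f\<in>E. {M. M f = L f}) \<noteq> {}"
  proof (rule compact_imp_fip_image)
    show "compact C" by fact
    show "closed {M. M f = L f}" for f
      by (intro closed_Collect_eq continuous_intros continuous_on_eval)
    show "C \<inter> (\<Inter>f\<in>F. {M. M f = L f}) \<noteq> {}" if "finite F" "F \<subseteq> E" for F
      using fin[OF that] by auto
  qed
  then obtain M where "M \<in> C" "\<forall>f\<in>E. M f = L f" by auto
  then have "M = L" using C(3) L(1) by (intro extensionalityI[of _ E]) auto
  then show ?thesis using \<open>M \<in> C\<close> by simp
qed

text \<open>The set of all sums with budgets \<open>s\<close> and \<open>1 - s\<close> is compact
  and convex, and since both bounds are attained, \<open>max (p1 f) (p2 f)\<close> is its support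
  function. Domination by the maximum therefore puts \<open>L\<close> into this set. The summands
  carry their weights already, which avoids dividing by a weight that may be zero.\<close>

lemma functional_decomposition:
  assumes E: "linear_space X E"
    and L: "L \<in> extensional E" "linear_functional_on X E L"
    and le: "\<And>f. f \<in> E \<Longrightarrow> norm (L f) \<le> max (p1 f) (p2 f)"
    and p1: "\<And>f. f \<in> E \<Longrightarrow> \<exists>M\<in>bounded_functionals X E p1. M f = of_real (p1 f)"
    and p2: "\<And>f. f \<in> E \<Longrightarrow> \<exists>M\<in>bounded_functionals X E p2. M f = of_real (p2 f)"
  obtains s M1 M2 where "0 \<le> s" "s \<le> 1"
    "M1 \<in> bounded_functionals X E (\<lambda>f. s * p1 f)" "M2 \<in> bounded_functionals X E (\<lambda>f. (1 - s) * p2 f)"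
    "\<And>f. f \<in> E \<Longrightarrow> L f = M1 f + M2 f"
proof -
  have nonneg: "0 \<le> p1 f" "0 \<le> p2 f" if "f \<in> E" for f
    using p1[OF that] p2[OF that] that unfolding bounded_functionals_def
    by (fastforce intro: order_trans[OF norm_ge_zero])+
  define P where "P = {(s, M1, M2). s \<in> {0..1} \<and> M1 \<in> bounded_functionals X E (\<lambda>f. s * p1 f) \<and>
     M2 \<in> bounded_functionals X E (\<lambda>f. (1 - s) * p2 f)}"
  define add where "add = (\<lambda>(s::real, M1, M2). \<lambda>f\<in>E. M1 f + M2 f :: complex)"
  \<comment> \<open>As \<open>s * p1 f \<le> p1 f\<close>, and similarly for \<open>p2\<close>, the
    summands stay in two fixed compact sets. What remains are inequalities that are closed in the
    triple, because \<open>s\<close> is one of its components.\<close>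
  have P_eq: "P = ({0..1} \<times> bounded_functionals X E p1 \<times> bounded_functionals X E p2) \<inter>
     (\<Inter>f\<in>E. {q. norm (fst (snd q) f) \<le> fst q * p1 f} \<inter> {q. norm (snd (snd q) f) \<le> (1 - fst q) * p2 f})"
  proof -
    have "norm (M f) \<le> p1 f" if "norm (M f) \<le> s * p1 f" "s \<in> {0..1}" "f \<in> E" for s M f
      using that nonneg(1)[OF that(3)] mult_right_mono[of s 1 "p1 f"] by auto
    moreover have "norm (M f) \<le> p2 f" if "norm (M f) \<le> (1 - s) * p2 f" "s \<in> {0..1}" "f \<in> E" for s M f
      using that nonneg(2)[OF that(3)] mult_right_mono[of "1 - s" 1 "p2 f"] by auto
    ultimately show ?thesis
      unfolding P_def bounded_functionals_def by auto blast+
  qed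
  have "compact P"
    unfolding P_eq
    by (intro compact_Int_closed compact_Times compact_Icc compact_bounded_functionals closed_INT
        ballI closed_Int closed_Collect_le continuous_intros continuous_on_eval_pair)
  moreover have "continuous_on P add"
  proof (rule continuous_on_coordinatewise_then_product)
    show "continuous_on P (\<lambda>q. add q f)" for f
      by (cases "f \<in> E")
        (auto simp: add_def case_prod_unfold intro!: continuous_intros continuous_on_eval_pair)
  qed
  ultimately have comp: "compact (add ` P)" by (rule compact_continuous_image[rotated])
  have lin: "linear_functional_on X E M" if "M \<in> add ` P" for M
  proof -
    from that obtain s M1 M2 where "(s, M1, M2) \<in> P" "M = add (s, M1, M2)" by auto
    then show ?thesis
      using linear_functional_on_comb[of X E M1 M2 1 1] E
      by (simp add: P_def add_def bounded_functionals_def)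
  qed
  have zero: "(\<lambda>f\<in>E. 0) \<in> bounded_functionals X E (\<lambda>f. 0)"
    using E by (auto simp: bounded_functionals_def linear_functional_on_def linear_space_def)
  \<comment> \<open>With \<open>s = 1\<close> or \<open>s = 0\<close> one summand is zero, so the
    functionals attaining \<open>p1 f\<close> and \<open>p2 f\<close> are themselves sums;
    domination is tested against them.\<close>
  have left: "M \<in> add ` P" if "M \<in> bounded_functionals X E p1" for M
    using that zero
    by (intro image_eqI[of _ _ "(1, M, \<lambda>f\<in>E. 0)"])
      (auto simp: add_def P_def bounded_functionals_def extensional_def)
  have right: "M \<in> add ` P" if "M \<in> bounded_functionals X E p2" for M
    using that zero
    by (intro image_eqI[of _ _ "(0, \<lambda>f\<in>E. 0, M)"])
      (auto simp: add_def P_def bounded_functionals_def extensional_def)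
  have "L \<in> add ` P"
  proof (rule mem_compact_convex_functionals[OF E comp])
    obtain f where "f \<in> E" using E by (auto simp: linear_space_def)
    then show "add ` P \<noteq> {}" using p1 left by blast
    show "add ` P \<subseteq> extensional E" by (auto simp: add_def)
    show "linear_functional_on X E M" if "M \<in> add ` P" for M using lin that .
    show "L \<in> extensional E" "linear_functional_on X E L" by fact+
    show "\<exists>M\<in>add ` P. Re (L f) \<le> Re (M f)" if f: "f \<in> E" for f
    proof -
      have "Re (L f) \<le> max (p1 f) (p2 f)"
        using le[OF f] complex_Re_le_cmod order_trans by blast
      then consider "Re (L f) \<le> p1 f" | "Re (L f) \<le> p2 f" by linarith
      then show ?thesis
        using p1[OF f] p2[OF f] left right by cases (metis Re_complex_of_real)+
    qed
    show "(\<lambda>f\<in>E. of_real (1 - t) * M f + of_real t * N f) \<in> add ` P"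
      if MN: "M \<in> add ` P" "N \<in> add ` P" and t: "0 < t" "t < 1" for M N t
    proof -
      obtain s M1 M2 where M: "(s, M1, M2) \<in> P" "M = add (s, M1, M2)" using MN by auto
      obtain u N1 N2 where N: "(u, N1, N2) \<in> P" "N = add (u, N1, N2)" using MN by auto
      let ?c = "\<lambda>M N. \<lambda>f\<in>E. complex_of_real (1 - t) * M f + of_real t * N f"
      have *: "norm (of_real (1 - t) * a + of_real t * b) \<le> ((1 - t) * x + t * y) * z"
        if "norm a \<le> x * z" "norm b \<le> y * z" for a b :: complex and x y z
      proof -
        have "norm (of_real (1 - t) * a + of_real t * b) \<le> (1 - t) * norm a + t * norm b"
          using norm_triangle_ineq[of "of_real (1 - t) * a" "of_real t * b"] t
          by (simp add: norm_mult del: of_real_diff)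
        also have "\<dots> \<le> (1 - t) * (x * z) + t * (y * z)"
          using that t by (intro add_mono mult_left_mono) auto
        finally show ?thesis by (simp add: algebra_simps)
      qed
      \<comment> \<open>Budgets are averaged along with the functionals: a combination of sums with
        budgets \<open>s\<close> and \<open>u\<close> has budget
        \<open>(1 - t) * s + t * u\<close>.\<close>
      have 1: "?c M1 N1 \<in> bounded_functionals X E (\<lambda>f. ((1 - t) * s + t * u) * p1 f)"
        using M(1) N(1) linear_functional_on_comb[OF _ _ E, of M1 N1]
        by (auto simp: P_def bounded_functionals_def simp del: of_real_diff intro!: *)
      have "?c M2 N2 \<in> bounded_functionals X E (\<lambda>f. ((1 - t) * (1 - s) + t * (1 - u)) * p2 f)"
        using M(1) N(1) linear_functional_on_comb[OF _ _ E, of M2 N2]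
        by (auto simp: P_def bounded_functionals_def simp del: of_real_diff intro!: *)
      moreover have "(1 - t) * (1 - s) + t * (1 - u) = 1 - ((1 - t) * s + t * u)"
        by (simp add: algebra_simps)
      moreover have "(1 - t) * s + t * u \<in> {0..1}"
        using M(1) N(1) t convex_bound_le[of s 1 u "1 - t" t] by (auto simp: P_def)
      ultimately have "((1 - t) * s + t * u, ?c M1 N1, ?c M2 N2) \<in> P"
        using 1 by (simp add: P_def del: of_real_diff)
      moreover have "?c M N = add ((1 - t) * s + t * u, ?c M1 N1, ?c M2 N2)"
        using M N by (auto simp: add_def fun_eq_iff algebra_simps)
      ultimately show ?thesis by blast
    qed
  qed
  then obtain s M1 M2 where "(s, M1, M2) \<in> P" "L = add (s, M1, M2)" by auto
  then show ?thesis
    using that[of s M1 M2] by (auto simp: P_def add_def)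
qed

subsection \<open>Extreme points of the dual ball\<close>

context
  fixes X :: "'a topology" and f :: "'a \<Rightarrow> complex"
  assumes X: "compact_space X" and f: "f \<in> cfuns X"
begin

lemma norm_attains_max_on:
  assumes "compactin X Z" "Z \<noteq> {}"
  obtains x where "x \<in> Z" "\<And>z. z \<in> Z \<Longrightarrow> norm (f z) \<le> norm (f x)"
proof -
  have "continuous_map X euclideanreal (\<lambda>x. norm (f x))"
    using f by (simp add: cfuns_def continuous_map_norm)
  then have "compact ((\<lambda>x. norm (f x)) ` Z)"
    using assms(1) image_compactin by fastforce
  then obtain r where "r \<in> (\<lambda>x. norm (f x)) ` Z" "\<forall>t\<in>(\<lambda>x. norm (f x)) ` Z. t \<le> r"
    using compact_attains_sup assms(2) by (metis image_is_empty)
  then show ?thesis using that by auto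
qed

text \<open>The empty carrier supports only one function, so the distance that defines
  \<open>supnorm\<close> is zero there; the formula by a supremum does not cover this case.\<close>

lemma supnorm_empty: "topspace X = {} \<Longrightarrow> supnorm X f = 0"
proof -
  assume "topspace X = {}"
  then have "fconst X 0 = f" using f by (auto simp: fconst_def cfuns_def extensional_def fun_eq_iff)
  then show ?thesis
    using f mspace_sup_metric[OF X] by (simp add: supnorm_def)
qed

lemma supnorm_attained:
  assumes "topspace X \<noteq> {}"
  obtains x where "x \<in> topspace X" "supnorm X f = norm (f x)" "\<And>z. z \<in> topspace X \<Longrightarrow> norm (f z) \<le> norm (f x)"
proof -
  obtain x where x: "x \<in> topspace X" "\<And>z. z \<in> topspace X \<Longrightarrow> norm (f z) \<le> norm (f x)"
    using norm_attains_max_on[of "topspace X"] X assms by (auto simp: compact_space_def)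
  then have "(SUP z\<in>topspace X. norm (f z)) = norm (f x)"
    by (intro cSup_eq_maximum) auto
  then show ?thesis using that x supnorm_eq_SUP[OF X assms f] by auto
qed

lemma norm_le_supnorm: "x \<in> topspace X \<Longrightarrow> norm (f x) \<le> supnorm X f"
  by (metis empty_iff supnorm_attained)

lemma supnorm_nonneg: "0 \<le> supnorm X f"
  by (metis norm_ge_zero order.refl supnorm_attained supnorm_empty)

lemma supnorm_le: "0 \<le> r \<Longrightarrow> (\<And>x. x \<in> topspace X \<Longrightarrow> norm (f x) \<le> r) \<Longrightarrow> supnorm X f \<le> r"
  by (metis supnorm_attained supnorm_empty)

end

lemma linear_space_cfuns: "linear_space X E \<Longrightarrow> f \<in> E \<Longrightarrow> f \<in> cfuns X"
  by (auto simp: linear_space_def)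

lemma scaled_point_eval_in_dual_unit_ball:
  assumes "compact_space X" "linear_space X E" "x \<in> topspace X" "norm c \<le> 1"
  shows "(\<lambda>f\<in>E. c * f x) \<in> dual_unit_ball X E"
proof -
  have "norm (c * f x) \<le> supnorm X f" if "f \<in> E" for f
    using norm_le_supnorm[OF assms(1) linear_space_cfuns[OF assms(2) that] assms(3)]
      mult_right_mono[OF assms(4) norm_ge_zero[of "f x"]] by (simp add: norm_mult)
  then show ?thesis
    using assms(2,3) by (auto simp: dual_unit_ball_def linear_functional_on_def linear_space_def
        fadd_def fscale_def algebra_simps)
qed

lemma extreme_pointD:
  assumes L: "L \<in> dual_ball_extreme_points X E"
    and L12: "L1 \<in> dual_unit_ball X E" "L2 \<in> dual_unit_ball X E" and t: "0 < t" "t < 1"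
    and eq: "\<And>f. f \<in> E \<Longrightarrow> L f = of_real (1 - t) * L1 f + of_real t * L2 f"
  shows "L1 = L2" "L = L1"
proof -
  have ext: "L \<in> extensional E" "L1 \<in> extensional E"
    using L L12 by (auto simp: dual_ball_extreme_points_def dual_unit_ball_def)
  have "L = (\<lambda>f\<in>E. of_real (1 - t) * L1 f + of_real t * L2 f)"
    using ext(1) eq by (intro extensionalityI[of _ E]) (auto simp del: of_real_diff)
  then show "L1 = L2"
    using L L12 t unfolding dual_ball_extreme_points_def by blast
  then have "L f = L1 f" if "f \<in> E" for f
    using eq[OF that] by (simp add: algebra_simps)
  then show "L = L1" using ext by (intro extensionalityI[of _ E])
qed

text \<open>If both weights in the splitting of \<open>L\<close> over \<open>Z1\<close> and
  \<open>Z2\<close> are positive, dividing by them writes \<open>L\<close> as a proper convex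
  combination of two members of the dual ball. By extremality \<open>L\<close> is the first of them,
  which is dominated on \<open>Z1\<close>. If a weight is zero, \<open>L\<close> is dominated on the
  other set at once.\<close>

lemma extreme_point_prime:
  assumes X: "compact_space X" and E: "linear_space X E"
    and L: "L \<in> dual_ball_extreme_points X E"
    and Z: "compactin X Z1" "compactin X Z2"
    and le: "\<And>f. f \<in> E \<Longrightarrow> \<exists>x\<in>Z1 \<union> Z2. norm (L f) \<le> norm (f x)"
  shows "(\<forall>f\<in>E. \<exists>x\<in>Z1. norm (L f) \<le> norm (f x)) \<or> (\<forall>f\<in>E. \<exists>x\<in>Z2. norm (L f) \<le> norm (f x))"
proof (cases "Z1 = {} \<or> Z2 = {}")
  case True
  then show ?thesis using le by auto
next
  case False
  \<comment> \<open>Choosing maximum points expresses the supremum of \<open>norm f\<close> over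
    \<open>Z\<close> as \<open>norm (f (m f))\<close>.\<close>
  have max: "\<exists>m. \<forall>f\<in>E. m f \<in> Z \<and> (\<forall>z\<in>Z. norm (f z) \<le> norm (f (m f)))"
    if "compactin X Z" "Z \<noteq> {}" for Z
    using norm_attains_max_on[OF X linear_space_cfuns[OF E] that] by (intro bchoice ballI) metis
  obtain m1 where m1: "\<And>f. f \<in> E \<Longrightarrow> m1 f \<in> Z1" "\<And>f z. f \<in> E \<Longrightarrow> z \<in> Z1 \<Longrightarrow> norm (f z) \<le> norm (f (m1 f))"
    using max[OF Z(1)] False by metis
  obtain m2 where m2: "\<And>f. f \<in> E \<Longrightarrow> m2 f \<in> Z2" "\<And>f z. f \<in> E \<Longrightarrow> z \<in> Z2 \<Longrightarrow> norm (f z) \<le> norm (f (m2 f))"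
    using max[OF Z(2)] False by metis
  have sub: "Z1 \<subseteq> topspace X" "Z2 \<subseteq> topspace X" using Z by (auto simp: compactin_def)
  \<comment> \<open>Evaluation at the maximum point of \<open>g\<close>, rotated by the conjugate
    sign of the value there, attains the bound at \<open>g\<close>.\<close>
  have norming: "\<exists>M\<in>bounded_functionals X E (\<lambda>f. norm (f (m f))). M g = of_real (norm (g (m g)))"
    if g: "g \<in> E" and m: "m g \<in> topspace X" "\<And>f. f \<in> E \<Longrightarrow> norm (f (m g)) \<le> norm (f (m f))" for m g
  proof (rule bexI[of _ "\<lambda>f\<in>E. cnj (sgn (g (m g))) * f (m g)"])
    show "(\<lambda>f\<in>E. cnj (sgn (g (m g))) * f (m g)) g = of_real (norm (g (m g)))"
      using g complex_norm_square[of "g (m g)"]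
      by (cases "g (m g) = 0") (simp_all add: sgn_eq power2_eq_square divide_eq_eq mult.commute)
    have "norm (cnj (sgn (g (m g)))) \<le> 1" by (simp add: norm_sgn)
    then have "norm (cnj (sgn (g (m g))) * f (m g)) \<le> norm (f (m f))" if "f \<in> E" for f
      using m(2)[OF that] mult_right_mono[of "norm (cnj (sgn (g (m g))))" 1 "norm (f (m g))"]
      by (simp add: norm_mult)
    then show "(\<lambda>f\<in>E. cnj (sgn (g (m g))) * f (m g)) \<in> bounded_functionals X E (\<lambda>f. norm (f (m f)))"
      using scaled_point_eval_in_dual_unit_ball[OF X E m(1), of "cnj (sgn (g (m g)))"]
      by (auto simp: bounded_functionals_def dual_unit_ball_def norm_sgn)
  qed
  have Lball: "L \<in> extensional E" "linear_functional_on X E L"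
    using L by (auto simp: dual_ball_extreme_points_def dual_unit_ball_def)
  have Lle: "norm (L f) \<le> max (norm (f (m1 f))) (norm (f (m2 f)))" if "f \<in> E" for f
    using le[OF that] m1(2)[OF that] m2(2)[OF that] by (fastforce simp: le_max_iff_disj)
  obtain s M1 M2 where s: "0 \<le> s" "s \<le> 1"
    and M1: "M1 \<in> bounded_functionals X E (\<lambda>f. s * norm (f (m1 f)))"
    and M2: "M2 \<in> bounded_functionals X E (\<lambda>f. (1 - s) * norm (f (m2 f)))"
    and LM: "\<And>f. f \<in> E \<Longrightarrow> L f = M1 f + M2 f"
  proof (rule functional_decomposition[OF E Lball Lle])
    show "\<exists>M\<in>bounded_functionals X E (\<lambda>f. norm (f (m1 f))). M f = of_real (norm (f (m1 f)))" if "f \<in> E" for f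
      using norming[of f m1] that m1 sub by blast
    show "\<exists>M\<in>bounded_functionals X E (\<lambda>f. norm (f (m2 f))). M f = of_real (norm (f (m2 f)))" if "f \<in> E" for f
      using norming[of f m2] that m2 sub by blast
  qed blast+
  consider "s = 0" | "s = 1" | "0 < s" "s < 1" using s by linarith
  then show ?thesis
  proof cases
    case 1
    then have "norm (L f) \<le> norm (f (m2 f))" if "f \<in> E" for f
      using M1 M2 LM that by (fastforce simp: bounded_functionals_def)
    then show ?thesis using m2 by blast
  next
    case 2
    then have "norm (L f) \<le> norm (f (m1 f))" if "f \<in> E" for f
      using M1 M2 LM that by (fastforce simp: bounded_functionals_def)
    then show ?thesis using m1 by blast
  next
    case 3
    have *: "norm (of_real (inverse r) * a) \<le> p" if "norm a \<le> r * p" "0 < r" for a :: complex and r p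
    proof -
      have "norm (of_real (inverse r) * a) = norm a / r"
        using that by (simp add: norm_mult norm_inverse divide_inverse mult.commute)
      then show ?thesis using that by (simp add: divide_le_eq mult.commute)
    qed
    let ?L1 = "\<lambda>f\<in>E. complex_of_real (inverse s) * M1 f"
    let ?L2 = "\<lambda>f\<in>E. complex_of_real (inverse (1 - s)) * M2 f"
    have L1: "norm (?L1 f) \<le> norm (f (m1 f))" if "f \<in> E" for f
      using M1 that 3(1) *[of "M1 f" s "norm (f (m1 f))"] by (simp add: bounded_functionals_def del: of_real_inverse)
    have L2: "norm (?L2 f) \<le> norm (f (m2 f))" if "f \<in> E" for f
      using M2 that 3(2) *[of "M2 f" "1 - s" "norm (f (m2 f))"]
      by (simp add: bounded_functionals_def del: of_real_inverse of_real_diff)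
    have "?L1 \<in> dual_unit_ball X E"
      using M1 linear_functional_on_scale[OF _ E] L1 m1(1) sub(1)
        norm_le_supnorm[OF X linear_space_cfuns[OF E]] order_trans
      unfolding dual_unit_ball_def bounded_functionals_def by blast
    moreover have "?L2 \<in> dual_unit_ball X E"
      using M2 linear_functional_on_scale[OF _ E] L2 m2(1) sub(2)
        norm_le_supnorm[OF X linear_space_cfuns[OF E]] order_trans
      unfolding dual_unit_ball_def bounded_functionals_def by blast
    \<comment> \<open>In the definition of an extreme point the parameter is the weight of the
      second functional, so here it is \<open>1 - s\<close>.\<close>
    moreover have "L f = of_real (1 - (1 - s)) * ?L1 f + of_real (1 - s) * ?L2 f" if "f \<in> E" for f
    proof -
      have cancel: "of_real r * (of_real (inverse r) * z) = z" if "r \<noteq> 0" for r :: real and z :: complex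
        using that by simp
      then show ?thesis
        using LM[OF that] that 3 by (simp add: cancel del: of_real_diff of_real_inverse)
    qed
    ultimately have "L = ?L1"
      using extreme_pointD(2)[OF L] 3 by (metis diff_gt_0_iff_gt diff_less_eq less_add_same_cancel1)
    then have "norm (L f) \<le> norm (f (m1 f))" if "f \<in> E" for f
      using L1[OF that] by (simp only:)
    then show ?thesis using m1(1) by blast
  qed
qed

section \<open>Extreme functionals are unimodular multiples of point evaluations\<close>

definition nonvanishing :: "'a topology \<Rightarrow> ('a \<Rightarrow> complex) set \<Rightarrow> bool" where
  "nonvanishing X E \<longleftrightarrow> (\<forall>x\<in>topspace X. \<exists>f\<in>E. f x \<noteq> 0)"

text \<open>
  If \<open>L\<close> were not dominated by any point evaluation, compactness would give a finite closed cover none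
  of whose members carries \<open>L\<close>, contradicting primeness.
\<close>

lemma extreme_point_is_eval:
  assumes X: "compact_space X" "topspace X \<noteq> {}" and E: "linear_space X E" "nonvanishing X E"
    and L: "L \<in> dual_ball_extreme_points X E"
  obtains x c where "x \<in> topspace X" "norm c = 1" "L = (\<lambda>f\<in>E. c * f x)"
proof -
  have Lball: "L \<in> extensional E" "linear_functional_on X E L"
    and Lle: "\<And>f. f \<in> E \<Longrightarrow> norm (L f) \<le> supnorm X f"
    using L by (auto simp: dual_ball_extreme_points_def dual_unit_ball_def)
  have "\<exists>x\<in>topspace X. \<forall>f\<in>E. norm (L f) \<le> norm (f x)"
  proof (rule ccontr)
    assume "\<not> ?thesis"
    then obtain F where F: "\<And>x. x \<in> topspace X \<Longrightarrow> F x \<in> E" "\<And>x. x \<in> topspace X \<Longrightarrow> norm (F x x) < norm (L (F x))"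
      by (metis not_le)
    \<comment> \<open>The midpoint of the gap: the open set \<open>U x\<close> still contains
      \<open>x\<close>, while on its closed companion \<open>N x\<close> the modulus of
      \<open>F x\<close> stays strictly below that of \<open>L (F x)\<close>, so \<open>N x\<close>
      cannot carry \<open>L\<close>.\<close>
    define r where "r x = (norm (F x x) + norm (L (F x))) / 2" for x
    have r: "norm (F x x) < r x" "r x < norm (L (F x))" if "x \<in> topspace X" for x
      using F(2)[OF that] by (auto simp: r_def)
    define U where "U x = {z \<in> topspace X. norm (F x z) \<in> {..<r x}}" for x
    define N where "N x = {z \<in> topspace X. norm (F x z) \<in> {..r x}}" for x
    have cont: "continuous_map X euclideanreal (\<lambda>z. norm (F x z))" if "x \<in> topspace X" for x
      using linear_space_cfuns[OF E(1) F(1)[OF that]] by (simp add: cfuns_def continuous_map_norm)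
    have U: "openin X (U x)" if "x \<in> topspace X" for x
      unfolding U_def using openin_continuous_map_preimage[OF cont[OF that], of "{..<r x}"] by simp
    have N: "compactin X (N x)" if "x \<in> topspace X" for x
      unfolding N_def using closedin_continuous_map_preimage[OF cont[OF that], of "{..r x}"] X(1)
      by (simp add: closedin_compact_space)
    have "topspace X \<subseteq> \<Union> (U ` topspace X)" using r(1) by (auto simp: U_def)
    then have "\<exists>\<F>. finite \<F> \<and> \<F> \<subseteq> U ` topspace X \<and> topspace X \<subseteq> \<Union>\<F>"
      using X(1)[unfolded compact_space_alt, rule_format, of "U ` topspace X"] U by blast
    then obtain D where D: "finite D" "D \<subseteq> topspace X" "topspace X \<subseteq> \<Union> (U ` D)"
      by (metis finite_subset_image)
    have prime: "\<exists>x\<in>D'. \<forall>f\<in>E. \<exists>z\<in>N x. norm (L f) \<le> norm (f z)"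
      if "finite D'" "D' \<subseteq> topspace X" "\<And>f. f \<in> E \<Longrightarrow> \<exists>z\<in>\<Union> (N ` D'). norm (L f) \<le> norm (f z)" for D'
      using that
    proof (induction D' rule: finite_induct)
      case empty
      then show ?case using E by (auto simp: linear_space_def)
    next
      case (insert x D')
      have "compactin X (\<Union> (N ` D'))" "compactin X (N x)"
        using N insert by (auto intro!: compactin_Union)
      then have "(\<forall>f\<in>E. \<exists>z\<in>N x. norm (L f) \<le> norm (f z)) \<or> (\<forall>f\<in>E. \<exists>z\<in>\<Union> (N ` D'). norm (L f) \<le> norm (f z))"
        using insert.prems(2) by (intro extreme_point_prime[OF X(1) E(1) L]) auto
      then show ?case
        using insert by (metis insert_iff insert_subset)
    qed
    have "\<exists>z\<in>\<Union> (N ` D). norm (L f) \<le> norm (f z)" if "f \<in> E" for f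
    proof -
      obtain z where "z \<in> topspace X" "supnorm X f = norm (f z)"
        using supnorm_attained[OF X(1) linear_space_cfuns[OF E(1) \<open>f \<in> E\<close>] X(2)] by metis
      then show ?thesis using Lle[OF \<open>f \<in> E\<close>] D(3) by (force simp: U_def N_def)
    qed
    then obtain x where "x \<in> topspace X" "\<forall>f\<in>E. \<exists>z\<in>N x. norm (L f) \<le> norm (f z)"
      using prime[OF D(1,2)] D(2) by blast
    then show False using F(1) r(2) by (fastforce simp: N_def)
  qed
  then obtain x where x: "x \<in> topspace X" "\<And>f. f \<in> E \<Longrightarrow> norm (L f) \<le> norm (f x)" by blast
  obtain f0 where f0: "f0 \<in> E" "f0 x \<noteq> 0" using E(2) x(1) by (auto simp: nonvanishing_def)
  define c where "c = L f0 / f0 x"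
  have Lc: "L f = c * f x" if f: "f \<in> E" for f
  proof -
    \<comment> \<open>This combination vanishes at \<open>x\<close>, so domination at
      \<open>x\<close> annihilates its image under \<open>L\<close>, and \<open>L f\<close> depends
      on \<open>f x\<close> alone.\<close>
    let ?g = "fadd X f (fscale X (- f x / f0 x) f0)"
    have s: "fscale X (- f x / f0 x) f0 \<in> E" "?g \<in> E" using E(1) f f0 by (auto simp: linear_space_def)
    have "?g x = 0" using x f0 by (simp add: fadd_def fscale_def)
    then have "L ?g = 0" using x(2)[OF s(2)] by simp
    then have "L f - f x / f0 x * L f0 = 0"
      using Lball(2) f f0(1) s by (simp add: linear_functional_on_def)
    then show ?thesis by (simp add: c_def field_simps)
  qed
  then have L_eq: "L = (\<lambda>f\<in>E. c * f x)"
    using Lball(1) by (intro extensionalityI[of _ E]) auto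
  have "norm c \<le> 1"
    using x(2)[OF f0(1)] f0(2) by (simp add: c_def norm_divide)
  moreover have "\<not> norm c < 1"
  proof
    assume c: "norm c < 1"
    \<comment> \<open>Inside the unit disc \<open>c\<close> can move by \<open>r\<close> both ways,
      which would make \<open>L\<close> the midpoint of two elements of the dual ball; the value
      \<open>f0 x\<close>, being nonzero, tells them apart.\<close>
    define r where "r = 1 - norm c"
    have "norm (c + of_real r) \<le> 1" "norm (c - of_real r) \<le> 1"
      using c norm_triangle_ineq[of c "of_real r"] norm_triangle_ineq4[of c "of_real r"] unfolding r_def
      by (auto simp del: of_real_diff)
    then have "(\<lambda>f\<in>E. (c + of_real r) * f x) \<in> dual_unit_ball X E" "(\<lambda>f\<in>E. (c - of_real r) * f x) \<in> dual_unit_ball X E"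
      using scaled_point_eval_in_dual_unit_ball[OF X(1) E(1) x(1)] by auto
    moreover have "L f = of_real (1 - 1/2) * (\<lambda>f\<in>E. (c + of_real r) * f x) f + of_real (1/2) * (\<lambda>f\<in>E. (c - of_real r) * f x) f"
      if "f \<in> E" for f
      using that Lc[OF that] by (simp add: field_simps)
    ultimately have "(\<lambda>f\<in>E. (c + of_real r) * f x) = (\<lambda>f\<in>E. (c - of_real r) * f x)"
      by (intro extreme_pointD(1)[OF L, of _ _ "1/2"]) simp_all
    then have "(c + of_real r) * f0 x = (c - of_real r) * f0 x"
      using f0(1) by (auto dest: fun_cong[of _ _ f0])
    then have "of_real r = (0::complex)" using f0(2) by (simp add: algebra_simps)
    then show False using c by (simp add: r_def del: of_real_diff)
  qed
  ultimately have "norm c = 1" by simp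
  then show ?thesis using that x(1) L_eq by blast
qed

text \<open>Multiplication by a unimodular constant preserves the dual ball and convex combinations,
  hence also extremality.\<close>

lemma choquet_boundary_rotate:
  assumes X: "compact_space X" and E: "linear_space X E" and x: "x \<in> topspace X" and c: "norm c = 1"
    and L: "(\<lambda>f\<in>E. c * f x) \<in> dual_ball_extreme_points X E"
  shows "x \<in> choquet_boundary X E"
proof -
  have "point_eval E x \<in> dual_unit_ball X E"
    using scaled_point_eval_in_dual_unit_ball[OF X E x, of 1] by (simp add: point_eval_def)
  moreover have "L1 = L2"
    if L12: "L1 \<in> dual_unit_ball X E" "L2 \<in> dual_unit_ball X E" "0 < t" "t < 1"
      and eq: "point_eval E x = (\<lambda>f\<in>E. of_real (1 - t) * L1 f + of_real t * L2 f)" for L1 L2 t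
  proof -
    have rot: "(\<lambda>f\<in>E. c * M f) \<in> dual_unit_ball X E" if "M \<in> dual_unit_ball X E" for M
      using that linear_functional_on_scale[OF _ E] c by (auto simp: dual_unit_ball_def norm_mult)
    have eval: "f x = of_real (1 - t) * L1 f + of_real t * L2 f" if "f \<in> E" for f
      using fun_cong[OF eq, of f] that by (simp add: point_eval_def)
    have "c * f x = of_real (1 - t) * (c * L1 f) + of_real t * (c * L2 f)" if "f \<in> E" for f
      by (subst eval[OF that]) (simp only: distrib_left mult.left_commute)
    then have eq: "(\<lambda>f\<in>E. c * L1 f) = (\<lambda>f\<in>E. c * L2 f)"
      by (intro extreme_pointD(1)[OF L rot[OF L12(1)] rot[OF L12(2)] L12(3,4)]) simp
    then have "c * L1 f = c * L2 f" if "f \<in> E" for f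
      using that by (auto dest: fun_cong[of _ _ f])
    moreover have "c \<noteq> 0" using c by auto
    ultimately have "L1 f = L2 f" if "f \<in> E" for f using that by simp
    then show ?thesis
      using L12 by (intro extensionalityI[of _ E]) (auto simp: dual_unit_ball_def)
  qed
  ultimately show ?thesis
    using x by (auto simp: choquet_boundary_def dual_ball_extreme_points_def simp del: of_real_diff)
qed

section \<open>Closed faces of the dual ball and the existence of extreme functionals\<close>

definition functional_face ::
    "'a topology \<Rightarrow> ('a \<Rightarrow> complex) set \<Rightarrow> (('a \<Rightarrow> complex) \<Rightarrow> complex) set \<Rightarrow> bool" where
  "functional_face X E F \<longleftrightarrow> closed F \<and> F \<noteq> {} \<and> F \<subseteq> dual_unit_ball X E \<and>
     (\<forall>L1\<in>dual_unit_ball X E. \<forall>L2\<in>dual_unit_ball X E. \<forall>t::real.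
        0 < t \<and> t < 1 \<and> (\<lambda>f\<in>E. of_real (1 - t) * L1 f + of_real t * L2 f) \<in> F \<longrightarrow> L1 \<in> F \<and> L2 \<in> F)"

lemma functional_face_compact: "functional_face X E F \<Longrightarrow> compact F"
  unfolding functional_face_def dual_unit_ball_eq
  by (metis compact_Int_closed compact_bounded_functionals inf.absorb2)

text \<open>A real affine function whose maximum over a face is attained inside a segment of the
  face is constant along that segment. The factor \<open>c\<close> gives access to both the real and
  the imaginary part of the value at \<open>f\<close>.\<close>

lemma functional_face_maximizers:
  assumes F: "functional_face X E F" and f: "f \<in> E"
  shows "functional_face X E {L \<in> F. \<forall>M\<in>F. Re (c * M f) \<le> Re (c * L f)}" (is "functional_face X E ?G")
proof -
  have "?G = F \<inter> (\<Inter>M\<in>F. {L. Re (c * M f) \<le> Re (c * L f)})" by auto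
  moreover have "closed \<dots>"
    using F unfolding functional_face_def
    by (intro closed_Int closed_INT ballI closed_Collect_le continuous_intros continuous_on_eval) auto
  ultimately have "closed ?G" by simp
  moreover have "?G \<noteq> {}"
  proof -
    have "continuous_on F (\<lambda>L. Re (c * L f))" by (intro continuous_intros continuous_on_eval)
    moreover have "F \<noteq> {}" using F by (simp add: functional_face_def)
    ultimately show ?thesis
      using continuous_attains_sup[OF functional_face_compact[OF F], of "\<lambda>L. Re (c * L f)"] by blast
  qed
  moreover have "L1 \<in> ?G \<and> L2 \<in> ?G"
    if L12: "L1 \<in> dual_unit_ball X E" "L2 \<in> dual_unit_ball X E" and t: "0 < t" "t < 1"
      and G: "(\<lambda>f\<in>E. of_real (1 - t) * L1 f + of_real t * L2 f) \<in> ?G" for L1 L2 t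
  proof -
    have in_F: "L1 \<in> F" "L2 \<in> F"
      using F L12 t G unfolding functional_face_def by blast+
    let ?r = "\<lambda>L. Re (c * L f)"
    let ?s = "(1 - t) * ?r L1 + t * ?r L2"
    have "c * (of_real (1 - t) * L1 f + of_real t * L2 f) = of_real (1 - t) * (c * L1 f) + of_real t * (c * L2 f)"
      by (simp add: algebra_simps)
    then have "Re (c * (of_real (1 - t) * L1 f + of_real t * L2 f)) = ?s"
      by (simp only: plus_complex.sel Re_complex_of_real times_complex.sel Im_complex_of_real)
    then have le: "?r M \<le> ?s" if "M \<in> F" for M
      using G f that by (simp del: of_real_diff)
    have "0 \<le> t * (?r L2 - ?r L1)" "0 \<le> (1 - t) * (?r L1 - ?r L2)"
      using le[OF in_F(1)] le[OF in_F(2)] by (simp_all add: algebra_simps)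
    then have eq: "?r L1 = ?r L2" using t by (simp add: zero_le_mult_iff)
    have "?s = ?r L1" unfolding eq by (simp add: algebra_simps)
    then show ?thesis using le in_F eq by auto
  qed
  ultimately show ?thesis
    using F unfolding functional_face_def by blast
qed

text \<open>Each function \<open>Re (c * L f)\<close> is constant on a minimal face, since otherwise
  its maximizers would form a smaller one. With \<open>c = 1\<close> and \<open>c = \<i>\<close>
  this leaves a single point, and a one-point face is extreme.\<close>

lemma minimal_functional_face_singleton:
  assumes F: "functional_face X E F" and min: "\<And>G. functional_face X E G \<Longrightarrow> G \<subseteq> F \<Longrightarrow> G = F"
    and L: "L \<in> F"
  shows "L \<in> dual_ball_extreme_points X E"
proof -
  have "M = N" if "M \<in> F" "N \<in> F" for M N
  proof (rule extensionalityI[of _ E])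
    show "M \<in> extensional E" "N \<in> extensional E"
      using F that by (auto simp: functional_face_def dual_unit_ball_def)
    fix f assume f: "f \<in> E"
    have "Re (c * M f) = Re (c * N f)" for c
    proof -
      have "{L \<in> F. \<forall>M\<in>F. Re (c * M f) \<le> Re (c * L f)} = F"
        by (rule min[OF functional_face_maximizers[OF F f]]) blast
      then show ?thesis using that by (intro order.antisym) blast+
    qed
    from this[of 1] this[of \<i>] show "M f = N f" by (simp add: complex_eq_iff)
  qed
  then show ?thesis
    using F L unfolding functional_face_def dual_ball_extreme_points_def by blast
qed

text \<open>The search for a minimal face starts from the face of functionals norming
  \<open>g\<close> instead of the whole ball, so that the extreme functional it produces still
  attains the norm of \<open>g\<close>.\<close>

lemma exists_extreme_functional:
  assumes X: "compact_space X" "topspace X \<noteq> {}" and E: "linear_space X E" and g: "g \<in> E"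
  obtains L where "L \<in> dual_ball_extreme_points X E" "Re (L g) = supnorm X g"
proof -
  obtain x where x: "x \<in> topspace X" "supnorm X g = norm (g x)"
    using supnorm_attained[OF X(1) linear_space_cfuns[OF E g] X(2)] by metis
  let ?K = "dual_unit_ball X E"
  have "functional_face X E ?K"
    using scaled_point_eval_in_dual_unit_ball[OF X(1) E x(1), of 1] closed_bounded_functionals
    by (auto simp: functional_face_def dual_unit_ball_eq)
  define F0 where "F0 = {L \<in> ?K. \<forall>M\<in>?K. Re (1 * M g) \<le> Re (1 * L g)}"
  have F0: "functional_face X E F0"
    unfolding F0_def by (rule functional_face_maximizers[OF \<open>functional_face X E ?K\<close> g])
  have norming: "Re (L g) = supnorm X g" if "L \<in> F0" for L
  proof (rule order.antisym)
    show "Re (L g) \<le> supnorm X g"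
      using that g complex_Re_le_cmod order_trans unfolding F0_def dual_unit_ball_def by blast
    have "(\<lambda>f\<in>E. cnj (sgn (g x)) * f x) \<in> ?K"
      by (rule scaled_point_eval_in_dual_unit_ball[OF X(1) E x(1)]) (simp add: norm_sgn)
    moreover have "cnj (sgn (g x)) * g x = of_real (norm (g x))"
      using complex_norm_square[of "g x"]
      by (cases "g x = 0") (simp_all add: sgn_eq power2_eq_square divide_eq_eq mult.commute)
    ultimately show "supnorm X g \<le> Re (L g)"
      using that g x(2) unfolding F0_def by fastforce
  qed
  \<comment> \<open>Zorn's lemma yields maximal sets, whereas a minimal face is wanted; complements
    reverse the inclusion and turn the union of a chain into an intersection of faces.\<close>
  define A where "A = uminus ` {F. functional_face X E F \<and> F \<subseteq> F0}"
  have "\<exists>M\<in>A. \<forall>U\<in>A. M \<subseteq> U \<longrightarrow> U = M"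
  proof (rule subset_Zorn_nonempty)
    show "A \<noteq> {}" using F0 by (auto simp: A_def)
    show "\<Union>\<C> \<in> A" if "\<C> \<noteq> {}" and ch: "subset.chain A \<C>" for \<C>
    proof -
      define \<D> where "\<D> = uminus ` \<C>"
      have D: "functional_face X E F" "F \<subseteq> F0" if "F \<in> \<D>" for F
        using ch that by (auto simp: \<D>_def A_def subset.chain_def)
      have "\<D> \<noteq> {}" using \<open>\<C> \<noteq> {}\<close> by (simp add: \<D>_def)
      have chD: "subset.chain UNIV \<D>"
        using ch unfolding \<D>_def subset_chain_def by fastforce
      \<comment> \<open>Finitely many members of a chain have the smallest of them as intersection,
        and this is a nonempty face.\<close>
      have ne: "F0 \<inter> \<Inter>\<D> \<noteq> {}"
      proof (rule compact_imp_fip[OF functional_face_compact[OF F0]])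
        show "closed F" if "F \<in> \<D>" for F using D[OF that] by (simp add: functional_face_def)
        show "F0 \<inter> \<Inter>\<F> \<noteq> {}" if "finite \<F>" "\<F> \<subseteq> \<D>" for \<F>
        proof (cases "\<F> = {}")
          case True
          then show ?thesis using F0 by (simp add: functional_face_def)
        next
          case False
          have "subset.chain UNIV \<F>" using chD that(2) by (auto simp: subset_chain_def)
          then have "\<Inter>\<F> \<in> \<D>"
            using Inter_in_chain[OF that(1) False] that(2) by blast
          then show ?thesis using D by (auto simp: functional_face_def inf.absorb2)
        qed
      qed
      have sub: "\<Inter>\<D> \<subseteq> F0" using D \<open>\<D> \<noteq> {}\<close> by blast
      have "functional_face X E (\<Inter>\<D>)"
        unfolding functional_face_def
      proof (intro conjI ballI allI impI)
        show "closed (\<Inter>\<D>)"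
          using D by (intro closed_Inter) (simp add: functional_face_def)
        show "\<Inter>\<D> \<noteq> {}" using ne by blast
        show "\<Inter>\<D> \<subseteq> ?K" using sub unfolding F0_def by blast
        show "L1 \<in> \<Inter>\<D>" "L2 \<in> \<Inter>\<D>"
          if "L1 \<in> ?K" "L2 \<in> ?K" "0 < t \<and> t < 1 \<and> (\<lambda>f\<in>E. of_real (1 - t) * L1 f + of_real t * L2 f) \<in> \<Inter>\<D>" for L1 L2 t
          using D(1) that unfolding functional_face_def by blast+
      qed
      moreover have "\<Union>\<C> = - \<Inter>\<D>" by (auto simp: \<D>_def)
      ultimately show ?thesis using sub unfolding A_def by blast
    qed
  qed
  then obtain U where U: "U \<in> A" "\<And>V. V \<in> A \<Longrightarrow> U \<subseteq> V \<Longrightarrow> V = U" by blast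
  from U(1) obtain F where F: "functional_face X E F" "F \<subseteq> F0" "U = - F"
    by (auto simp: A_def)
  have min: "G = F" if "functional_face X E G" "G \<subseteq> F" for G
  proof -
    have "- G \<in> A" unfolding A_def using that F(2) by blast
    moreover have "U \<subseteq> - G" using that F(3) by blast
    ultimately show ?thesis using U(2) F(3) by blast
  qed
  obtain L where "L \<in> F" using F(1) by (auto simp: functional_face_def)
  have "L \<in> dual_ball_extreme_points X E"
    using minimal_functional_face_singleton[OF F(1) min \<open>L \<in> F\<close>] .
  then show ?thesis using that norming \<open>L \<in> F\<close> F(2) by blast
qed

text \<open>Some extreme functional attains the norm of \<open>g\<close>; being a multiple of
  evaluation at a Choquet boundary point, it sends \<open>g\<close> to zero.\<close>

lemma choquet_boundary_determines:
  assumes X: "compact_space X" and E: "linear_space X E" "nonvanishing X E" and g: "g \<in> E"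
    and zero: "\<And>x. x \<in> choquet_boundary X E \<Longrightarrow> g x = 0" and x: "x \<in> topspace X"
  shows "g x = 0"
proof -
  have ne: "topspace X \<noteq> {}" using x by blast
  obtain L where L: "L \<in> dual_ball_extreme_points X E" "Re (L g) = supnorm X g"
    using exists_extreme_functional[OF X ne E(1) g] .
  obtain y c where y: "y \<in> topspace X" "norm c = 1" "L = (\<lambda>f\<in>E. c * f y)"
    using extreme_point_is_eval[OF X ne E L(1)] .
  then have "g y = 0"
    using choquet_boundary_rotate[OF X E(1)] L(1) zero by blast
  then have "supnorm X g = 0" using L(2) y(3) g by simp
  then show ?thesis
    using norm_le_supnorm[OF X linear_space_cfuns[OF E(1) g] x] by simp
qed

section \<open>Linear isometries and their adjoints\<close>

lemma isometry_inj_on: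
  assumes X: "compact_space X" "linear_space X E" and Y: "compact_space Y" "linear_space Y F"
    and T: "linear_isometry_onto X E Y F T"
  shows "inj_on T E"
proof (rule inj_onI)
  fix f g assume fg: "f \<in> E" "g \<in> E" "T f = T g"
  let ?d = "fadd X f (fscale X (-1) g)"
  have d: "fscale X (-1) g \<in> E" "?d \<in> E" using X(2) fg by (auto simp: linear_space_def)
  have "T ?d = fadd Y (T f) (fscale Y (-1) (T g))"
    using T fg d by (simp add: linear_isometry_onto_def)
  then have "T ?d y = 0" if "y \<in> topspace Y" for y
    using fg(3) that by (simp add: fadd_def fscale_def)
  moreover have "T ?d \<in> cfuns Y"
    using T d linear_space_cfuns[OF Y(2)] by (auto simp: linear_isometry_onto_def)
  ultimately have "supnorm Y (T ?d) \<le> 0"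
    using supnorm_le[OF Y(1)] by simp
  then have "supnorm X ?d \<le> 0" using T d by (simp add: linear_isometry_onto_def)
  then have "norm (?d x) \<le> 0" if "x \<in> topspace X" for x
    using norm_le_supnorm[OF X(1) linear_space_cfuns[OF X(2) d(2)] that] by linarith
  then have "f x = g x" if "x \<in> topspace X" for x
    using that by (simp add: fadd_def fscale_def)
  then show "f = g"
    using linear_space_cfuns[OF X(2)] fg(1,2)
    by (intro extensionalityI[of _ "topspace X"]) (auto simp: cfuns_def)
qed

lemma isometry_inverse:
  assumes X: "compact_space X" "linear_space X E" and Y: "compact_space Y" "linear_space Y F"
    and T: "linear_isometry_onto X E Y F T"
  shows "linear_isometry_onto Y F X E (inv_into E T)"
proof -
  note inj = isometry_inj_on[OF assms]
  have onto: "T ` E = F" using T by (simp add: linear_isometry_onto_def)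
  have inv: "inv_into E T f \<in> E" "T (inv_into E T f) = f" if "f \<in> F" for f
    using that onto by (auto simp: inv_into_into f_inv_into_f)
  have eqI: "inv_into E T f = g" if "T g = f" "g \<in> E" for f g
    using inj that by auto
  show ?thesis
    unfolding linear_isometry_onto_def
  proof (intro conjI ballI allI)
    show "inv_into E T ` F = E" using inj onto by (metis bij_betw_def bij_betw_inv_into)
    show "inv_into E T (fadd Y f g) = fadd X (inv_into E T f) (inv_into E T g)" if "f \<in> F" "g \<in> F" for f g
      using T X(2) inv that by (intro eqI) (auto simp: linear_isometry_onto_def linear_space_def)
    show "inv_into E T (fscale Y c f) = fscale X c (inv_into E T f)" if "f \<in> F" for f c
      using T X(2) inv that by (intro eqI) (auto simp: linear_isometry_onto_def linear_space_def)
    show "supnorm X (inv_into E T f) = supnorm Y f" if "f \<in> F" for f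
      using T inv[OF that] by (metis linear_isometry_onto_def)
  qed
qed

lemma dual_ball_isometry_pullback:
  assumes "linear_space X E" "linear_isometry_onto X E Y F T" "L \<in> dual_unit_ball Y F"
  shows "(\<lambda>f\<in>E. L (T f)) \<in> dual_unit_ball X E"
  using assms
  by (auto simp: dual_unit_ball_def linear_isometry_onto_def linear_functional_on_def linear_space_def)

text \<open>The adjoint of \<open>T\<close> maps the dual balls affinely onto each other. The
  adjoint of the inverse isometry carries a convex decomposition of the pulled back functional to
  one of \<open>L\<close>.\<close>

lemma extreme_point_isometry_pullback:
  assumes X: "compact_space X" "linear_space X E" and Y: "compact_space Y" "linear_space Y F"
    and T: "linear_isometry_onto X E Y F T" and L: "L \<in> dual_ball_extreme_points Y F"
  shows "(\<lambda>f\<in>E. L (T f)) \<in> dual_ball_extreme_points X E"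
proof -
  let ?S = "inv_into E T"
  have S: "linear_isometry_onto Y F X E ?S" using isometry_inverse[OF assms(1-5)] .
  have onto: "T ` E = F" using T by (simp add: linear_isometry_onto_def)
  have "L1 = L2"
    if L12: "L1 \<in> dual_unit_ball X E" "L2 \<in> dual_unit_ball X E" and t: "0 < t" "t < 1"
      and eq: "(\<lambda>f\<in>E. L (T f)) = (\<lambda>f\<in>E. of_real (1 - t) * L1 f + of_real t * L2 f)" for L1 L2 t
  proof -
    let ?M = "\<lambda>L. \<lambda>f\<in>F. L (?S f)"
    have "L g = of_real (1 - t) * ?M L1 g + of_real t * ?M L2 g" if "g \<in> F" for g
    proof -
      have "?S g \<in> E" "T (?S g) = g" using that onto by (auto simp: inv_into_into f_inv_into_f)
      then show ?thesis using fun_cong[OF eq, of "?S g"] that by (simp del: of_real_diff)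
    qed
    then have M: "?M L1 = ?M L2"
      using dual_ball_isometry_pullback[OF Y(2) S] L12 t by (intro extreme_pointD(1)[OF L])
    have "L1 f = L2 f" if "f \<in> E" for f
      using fun_cong[OF M, of "T f"] that onto isometry_inj_on[OF assms(1-5)] by auto
    then show ?thesis
      using L12 by (intro extensionalityI[of _ E]) (auto simp: dual_unit_ball_def)
  qed
  then show ?thesis
    using L dual_ball_isometry_pullback[OF X(2) T]
    by (auto simp: dual_ball_extreme_points_def simp del: of_real_diff)
qed

lemma isometry_at_choquet_point:
  assumes X: "compact_space X" "linear_space X E" "nonvanishing X E"
    and Y: "compact_space Y" "linear_space Y F" "nonvanishing Y F"
    and T: "linear_isometry_onto X E Y F T" and y: "y \<in> choquet_boundary Y F"
  obtains x c where "x \<in> choquet_boundary X E" "norm c = 1" "\<And>f. f \<in> E \<Longrightarrow> T f y = c * f x"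
proof -
  have onto: "T ` E = F" using T by (simp add: linear_isometry_onto_def)
  have "(\<lambda>f\<in>E. point_eval F y (T f)) \<in> dual_ball_extreme_points X E" (is "?L \<in> _")
    using extreme_point_isometry_pullback[OF X(1,2) Y(1,2) T] y by (simp add: choquet_boundary_def)
  \<comment> \<open>Some image function is nonzero at \<open>y\<close>, so its preimage has positive
    norm and \<open>X\<close> has points; the description of extreme functionals presupposes
    this.\<close>
  have "y \<in> topspace Y" using y by (simp add: choquet_boundary_def)
  then obtain f where f: "f \<in> E" "T f y \<noteq> 0" using Y(3) onto by (auto simp: nonvanishing_def)
  then have "T f \<in> F" using onto by blast
  then have "0 < supnorm Y (T f)"
    using norm_le_supnorm[OF Y(1) linear_space_cfuns[OF Y(2)] \<open>y \<in> topspace Y\<close>, of "T f"] f(2)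
    by (meson less_le_trans zero_less_norm_iff)
  then have ne: "topspace X \<noteq> {}"
    using supnorm_empty[OF X(1) linear_space_cfuns[OF X(2) f(1)]] T f(1)
    by (auto simp: linear_isometry_onto_def)
  obtain x c where xc: "x \<in> topspace X" "norm c = 1" "?L = (\<lambda>f\<in>E. c * f x)"
    using extreme_point_is_eval[OF X(1) ne X(2,3) \<open>?L \<in> _\<close>] .
  show ?thesis
  proof (rule that[OF _ xc(2)])
    show "x \<in> choquet_boundary X E"
      using choquet_boundary_rotate[OF X(1,2) xc(1,2)] \<open>?L \<in> _\<close> xc(3) by simp
    show "T f y = c * f x" if "f \<in> E" for f
      using fun_cong[OF xc(3), of f] that onto by (auto simp: point_eval_def)
  qed
qed

subsection \<open>Isometries between weighted uniform algebras\<close>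

lemma uniform_algebra_linear_space:
  assumes "uniform_algebra X A"
  shows "linear_space X A" "nonvanishing X A"
proof -
  have one: "fconst X 1 \<in> A" using assms by (simp add: uniform_algebra_def)
  then show "linear_space X A"
    using assms by (auto simp: uniform_algebra_def linear_space_def)
  show "nonvanishing X A"
    unfolding nonvanishing_def using one by (auto intro!: bexI[of _ "fconst X 1"] simp: fconst_def)
qed

lemma weighted_in_cfuns:
  assumes "a \<in> cfuns X" "continuous_map X euclideanreal f"
  shows "weighted X f a \<in> cfuns X"
proof -
  have "continuous_map X euclidean (\<lambda>x. complex_of_real (f x))"
    using assms(2) continuous_map_compose[of X euclideanreal f euclidean complex_of_real]
    by (simp add: o_def continuous_on_of_real)
  then have "continuous_map X euclidean (\<lambda>x. a x * of_real (f x))"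
    using assms(1) by (simp add: cfuns_def continuous_map_atin tendsto_mult)
  then have "continuous_map X euclidean (weighted X f a)"
    by (rule continuous_map_eq) (simp add: weighted_def)
  then show ?thesis by (simp add: cfuns_def weighted_def)
qed

lemma weighted_fadd: "weighted X f (fadd X a b) = fadd X (weighted X f a) (weighted X f b)"
  by (auto simp: weighted_def fadd_def algebra_simps fun_eq_iff)

lemma weighted_fscale: "weighted X f (fscale X c a) = fscale X c (weighted X f a)"
  by (auto simp: weighted_def fscale_def fun_eq_iff)

lemma weighted_space_linear_space:
  assumes A: "linear_space X A" "nonvanishing X A"
    and f: "continuous_map X euclideanreal f" "\<forall>x\<in>topspace X. 0 < f x"
  shows "linear_space X (weighted_space X A f)" "nonvanishing X (weighted_space X A f)"
proof -
  show "linear_space X (weighted_space X A f)"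
    using A(1) weighted_in_cfuns[OF _ f(1)]
    unfolding linear_space_def weighted_space_def
    by (auto simp flip: weighted_fadd weighted_fscale)
  show "nonvanishing X (weighted_space X A f)"
    unfolding nonvanishing_def
  proof
    fix x assume x: "x \<in> topspace X"
    then obtain a where "a \<in> A" "a x \<noteq> 0" using A(2) by (auto simp: nonvanishing_def)
    moreover have "f x \<noteq> 0" using f(2) x by fastforce
    ultimately show "\<exists>g\<in>weighted_space X A f. g x \<noteq> 0"
      using x by (auto simp: weighted_space_def weighted_def intro!: bexI[of _ a])
  qed
qed

text \<open>One constant controls both \<open>f\<close> and \<open>1 / f\<close>: the maximum of
  \<open>f\<close> or the reciprocal of its minimum, whichever is larger.\<close>

lemma positive_continuous_bounds:
  assumes X: "compact_space X" and f: "continuous_map X euclideanreal f" "\<forall>x\<in>topspace X. 0 < f x"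
  obtains C where "0 < C" "\<And>x. x \<in> topspace X \<Longrightarrow> f x \<le> C" "\<And>x. x \<in> topspace X \<Longrightarrow> 1 \<le> C * f x"
proof (cases "topspace X = {}")
  case True
  then show ?thesis using that[of 1] by simp
next
  case False
  have K: "compact (f ` topspace X)" "f ` topspace X \<noteq> {}"
    using X f(1) False image_compactin[of X "topspace X" euclideanreal f]
    by (auto simp: compact_space_def)
  obtain x where x: "x \<in> topspace X" "\<And>z. z \<in> topspace X \<Longrightarrow> f z \<le> f x"
    using compact_attains_sup[OF K] by auto
  obtain y where y: "y \<in> topspace X" "\<And>z. z \<in> topspace X \<Longrightarrow> f y \<le> f z"
    using compact_attains_inf[OF K] by auto
  have pos: "0 < f x" "0 < f y" using f(2) x(1) y(1) by auto
  let ?C = "max (f x) (1 / f y)"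
  have "1 \<le> ?C * f z" if "z \<in> topspace X" for z
  proof -
    have "1 = 1 / f y * f y" using pos by simp
    also have "\<dots> \<le> ?C * f z"
      using y(2)[OF that] pos by (intro mult_mono) auto
    finally show ?thesis .
  qed
  then show ?thesis
    using that[of ?C] x(2) pos by (simp add: le_max_iff_disj less_max_iff_disj)
qed

text \<open>For \<open>0 < s < r\<close> the powers of \<open>r / s\<close> outgrow
  \<open>C\<close>. This removes the constant from an estimate that holds for all powers of a
  function.\<close>

lemma power_bound_imp_le:
  fixes r s C :: real
  assumes "\<And>n. r ^ n \<le> C * s ^ n" "0 \<le> s"
  shows "r \<le> s"
proof (rule ccontr)
  assume "\<not> r \<le> s"
  show False
  proof (cases "s = 0")
    case True
    then show ?thesis using assms(1)[of 1] \<open>\<not> r \<le> s\<close> by simp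
  next
    case False
    then have "0 < s" using assms(2) by simp
    then obtain n where "C < (r / s) ^ n"
      using real_arch_pow[of "r / s" C] \<open>\<not> r \<le> s\<close> by auto
    then have "C * s ^ n < r ^ n"
      using \<open>0 < s\<close> by (simp add: power_divide field_simps)
    then show ?thesis using assms(1)[of n] by simp
  qed
qed

section \<open>Maps into the maximal ideal space\<close>

lemma Hausdorff_maximal_ideal_space: "Hausdorff_space (maximal_ideal_space X A)"
  unfolding maximal_ideal_space_def
  by (intro Hausdorff_space_subtopology) (simp add: Hausdorff_space_product_topology)

text \<open>The family \<open>V\<close> covers two cases: \<open>V a = a\<close> embeds the space
  itself by point evaluations, and \<open>V = U\<close> will give \<open>\<phi>\<close>. Continuity
  is checked on coordinates because the Gelfand topology is that of pointwise convergence.\<close>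

lemma continuous_map_character_map:
  assumes V: "\<And>a. a \<in> A \<Longrightarrow> V a \<in> cfuns Y"
    and char: "\<And>y. y \<in> topspace Y \<Longrightarrow> (\<lambda>a\<in>A. V a y) \<in> characters X A"
  shows "continuous_map Y (maximal_ideal_space X A) (\<lambda>y. \<lambda>a\<in>A. V a y)"
  unfolding maximal_ideal_space_def continuous_map_in_subtopology continuous_map_componentwise
  using V char by (auto simp: cfuns_def)

lemma character_map_closed:
  assumes Y: "compact_space Y"
    and V: "\<And>a. a \<in> A \<Longrightarrow> V a \<in> cfuns Y"
    and char: "\<And>y. y \<in> topspace Y \<Longrightarrow> (\<lambda>a\<in>A. V a y) \<in> characters X A"
  shows "closed_map Y (maximal_ideal_space X A) (\<lambda>y. \<lambda>a\<in>A. V a y)"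
  by (rule continuous_imp_closed_map[OF continuous_map_character_map[OF V char] Y Hausdorff_maximal_ideal_space])

lemma character_map_embedding:
  assumes Y: "compact_space Y"
    and V: "\<And>a. a \<in> A \<Longrightarrow> V a \<in> cfuns Y"
    and char: "\<And>y. y \<in> topspace Y \<Longrightarrow> (\<lambda>a\<in>A. V a y) \<in> characters X A"
    and sep: "\<And>y z. y \<in> topspace Y \<Longrightarrow> z \<in> topspace Y \<Longrightarrow> y \<noteq> z \<Longrightarrow> \<exists>a\<in>A. V a y \<noteq> V a z"
  shows "embedding_map Y (maximal_ideal_space X A) (\<lambda>y. \<lambda>a\<in>A. V a y)"
proof (rule injective_closed_imp_embedding_map)
  show "continuous_map Y (maximal_ideal_space X A) (\<lambda>y. \<lambda>a\<in>A. V a y)"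
    using continuous_map_character_map[OF V char] .
  show "closed_map Y (maximal_ideal_space X A) (\<lambda>y. \<lambda>a\<in>A. V a y)"
    using character_map_closed[OF Y V char] .
  show "inj_on (\<lambda>y. \<lambda>a\<in>A. V a y) (topspace Y)"
    using sep by (intro inj_onI) (metis restrict_apply')
qed

text \<open>Equality, not just inclusion, lets an identity between images of Choquet boundaries pass
  to the Shilov boundaries.\<close>

lemma continuous_closed_map_image_closure_of:
  assumes "continuous_map X Y f" "closed_map X Y f" "S \<subseteq> topspace X"
  shows "f ` (X closure_of S) = Y closure_of (f ` S)"
  using assms(2,3)
  by (intro equalityI continuous_map_image_closure_subset[OF assms(1)]) (simp add: closed_map_closure_of_image)

lemma point_eval_character:
  assumes "uniform_algebra X A" "x \<in> topspace X"
  shows "(\<lambda>a\<in>A. a x) \<in> characters X A"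
proof -
  have "\<exists>a\<in>A. a x \<noteq> 0"
    using uniform_algebra_linear_space(2)[OF assms(1)] assms(2) by (simp add: nonvanishing_def)
  then show ?thesis
    using assms unfolding characters_def linear_functional_on_def
    by (auto simp: uniform_algebra_def fadd_def fmult_def fscale_def)
qed

lemma point_eval_map:
  assumes "compact_space X" "uniform_algebra X A"
  shows "embedding_map X (maximal_ideal_space X A) (point_eval A)"
    and "continuous_map X (maximal_ideal_space X A) (point_eval A)"
    and "closed_map X (maximal_ideal_space X A) (point_eval A)"
proof -
  have V: "a \<in> cfuns X" if "a \<in> A" for a using assms(2) that by (auto simp: uniform_algebra_def)
  note char = point_eval_character[OF assms(2)]
  have sep: "\<exists>a\<in>A. a x \<noteq> a y" if "x \<in> topspace X" "y \<in> topspace X" "x \<noteq> y" for x y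
    using assms(2) that by (auto simp: uniform_algebra_def)
  have eq: "point_eval A = (\<lambda>x. \<lambda>a\<in>A. a x)" by (auto simp: point_eval_def)
  show "embedding_map X (maximal_ideal_space X A) (point_eval A)"
    unfolding eq by (rule character_map_embedding[OF assms(1) V char sep])
  show "continuous_map X (maximal_ideal_space X A) (point_eval A)"
    unfolding eq by (rule continuous_map_character_map[OF V char])
  show "closed_map X (maximal_ideal_space X A) (point_eval A)"
    unfolding eq by (rule character_map_closed[OF assms(1) V char])
qed

section \<open>The isometry with the weights divided out\<close>

locale weighted_isometry =
  fixes X1 :: "'a topology" and X2 :: "'b topology"
    and A :: "('a \<Rightarrow> complex) set" and B :: "('b \<Rightarrow> complex) set"
    and f1 :: "'a \<Rightarrow> real" and f2 :: "'b \<Rightarrow> real"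
    and T :: "('a \<Rightarrow> complex) \<Rightarrow> 'b \<Rightarrow> complex"
  assumes X1: "compact_space X1" and X2: "compact_space X2"
    and A: "uniform_algebra X1 A" and B: "uniform_algebra X2 B"
    and f1: "continuous_map X1 euclideanreal f1" "\<forall>x\<in>topspace X1. 0 < f1 x"
    and f2: "continuous_map X2 euclideanreal f2" "\<forall>y\<in>topspace X2. 0 < f2 y"
    and T: "linear_isometry_onto X1 (weighted_space X1 A f1) X2 (weighted_space X2 B f2) T"
begin

abbreviation "E1 \<equiv> weighted_space X1 A f1"
abbreviation "E2 \<equiv> weighted_space X2 B f2"
abbreviation "one1 \<equiv> fconst X1 1"
abbreviation "one2 \<equiv> fconst X2 1"

lemmas A_space = uniform_algebra_linear_space[OF A]
lemmas B_space = uniform_algebra_linear_space[OF B]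
lemmas E1_space = weighted_space_linear_space[OF A_space f1]
lemmas E2_space = weighted_space_linear_space[OF B_space f2]

lemma A_closed:
  "a \<in> A \<Longrightarrow> b \<in> A \<Longrightarrow> fadd X1 a b \<in> A" "a \<in> A \<Longrightarrow> b \<in> A \<Longrightarrow> fmult X1 a b \<in> A"
  "a \<in> A \<Longrightarrow> fscale X1 c a \<in> A" "fconst X1 c \<in> A" "a \<in> A \<Longrightarrow> a \<in> cfuns X1"
  using A by (auto simp: uniform_algebra_def)

lemma B_closed:
  "a \<in> B \<Longrightarrow> b \<in> B \<Longrightarrow> fadd X2 a b \<in> B" "a \<in> B \<Longrightarrow> b \<in> B \<Longrightarrow> fmult X2 a b \<in> B"
  "a \<in> B \<Longrightarrow> fscale X2 c a \<in> B" "fconst X2 c \<in> B" "a \<in> B \<Longrightarrow> a \<in> cfuns X2"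
  using B by (auto simp: uniform_algebra_def)

lemma B_eqI: "a \<in> B \<Longrightarrow> b \<in> B \<Longrightarrow> (\<And>y. y \<in> topspace X2 \<Longrightarrow> a y = b y) \<Longrightarrow> a = b"
  using B_closed(5) by (intro extensionalityI[of _ "topspace X2"]) (auto simp: cfuns_def)

lemma f2_nonzero: "y \<in> topspace X2 \<Longrightarrow> f2 y \<noteq> 0"
  using f2(2) by fastforce

lemma weighted_E1: "a \<in> A \<Longrightarrow> weighted X1 f1 a \<in> E1"
  by (simp add: weighted_space_def)

definition S :: "('a \<Rightarrow> complex) \<Rightarrow> 'b \<Rightarrow> complex" where
  "S a = (\<lambda>y\<in>topspace X2. T (weighted X1 f1 a) y / of_real (f2 y))"

definition h :: "'b \<Rightarrow> complex" where "h = S one1"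

lemma S_weighted:
  assumes "a \<in> A"
  shows "S a \<in> B" and "y \<in> topspace X2 \<Longrightarrow> T (weighted X1 f1 a) y = S a y * of_real (f2 y)"
proof -
  have "T (weighted X1 f1 a) \<in> E2"
    using T weighted_E1[OF assms] by (auto simp: linear_isometry_onto_def)
  then obtain b where b: "b \<in> B" "T (weighted X1 f1 a) = weighted X2 f2 b"
    by (auto simp: weighted_space_def)
  have "S a = b"
    unfolding S_def b(2) using B_closed(5)[OF b(1)] f2_nonzero
    by (intro extensionalityI[of _ "topspace X2"]) (auto simp: cfuns_def weighted_def)
  then show "S a \<in> B" using b(1) by simp
  show "T (weighted X1 f1 a) y = S a y * of_real (f2 y)" if "y \<in> topspace X2"
    using that f2_nonzero by (simp add: S_def)
qed

lemma S_linear: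
  assumes "y \<in> topspace X2" "a \<in> A" "b \<in> A"
  shows "S (fadd X1 a b) y = S a y + S b y" "S (fscale X1 c a) y = c * S a y"
  using T weighted_E1 assms
  by (simp_all add: S_def linear_isometry_onto_def weighted_fadd weighted_fscale fadd_def[of X2]
      fscale_def[of X2] add_divide_distrib)

lemma S_onto:
  assumes "b \<in> B"
  obtains a where "a \<in> A" "S a = b"
proof -
  have "weighted X2 f2 b \<in> T ` E1"
    using T assms by (auto simp: linear_isometry_onto_def weighted_space_def)
  then obtain a where a: "a \<in> A" "T (weighted X1 f1 a) = weighted X2 f2 b"
    by (auto simp: weighted_space_def)
  have "S a = b"
    unfolding S_def a(2) using B_closed(5)[OF assms] f2_nonzero
    by (intro extensionalityI[of _ "topspace X2"]) (auto simp: cfuns_def weighted_def)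
  then show ?thesis using that a(1) by blast
qed

lemma S_at_choquet_point:
  assumes "y \<in> choquet_boundary X2 E2"
  obtains x c where "x \<in> topspace X1" "norm c = 1"
    "\<And>a. a \<in> A \<Longrightarrow> S a y * of_real (f2 y) = c * (a x * of_real (f1 x))"
proof -
  obtain x c where xc: "x \<in> choquet_boundary X1 E1" "norm c = 1"
    "\<And>f. f \<in> E1 \<Longrightarrow> T f y = c * f x"
    using isometry_at_choquet_point[OF X1 E1_space X2 E2_space T assms] by blast
  moreover have "x \<in> topspace X1" "y \<in> topspace X2"
    using xc(1) assms by (auto simp: choquet_boundary_def)
  ultimately show ?thesis
    using that[of x c] S_weighted(2) weighted_E1 by (force simp: weighted_def)
qed

text \<open>Both sides have degree two: at a Choquet boundary point \<open>z\<close> of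
  \<open>E2\<close> each equals \<open>(c * f1 x / f2 z)^2 * a x * b x\<close>. The factor
  \<open>h\<close> on the left supplies the second copy of the unknown multiplier.\<close>

lemma S_mult:
  assumes ab: "a \<in> A" "b \<in> A" and y: "y \<in> topspace X2"
  shows "S (fmult X1 a b) y * h y = S a y * S b y"
proof -
  let ?k = "fadd X2 (fmult X2 (S (fmult X1 a b)) h) (fscale X2 (-1) (fmult X2 (S a) (S b)))"
  have "?k \<in> B"
    using S_weighted(1) A_closed B_closed ab by (simp add: h_def)
  \<comment> \<open>The boundary in question determines elements of \<open>E2\<close>, so the
    difference of the two sides is multiplied by \<open>f2\<close> first.\<close>
  then have k: "weighted X2 f2 ?k \<in> E2" by (simp add: weighted_space_def)
  have "weighted X2 f2 ?k z = 0" if "z \<in> choquet_boundary X2 E2" for z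
  proof -
    have z: "z \<in> topspace X2" using that by (simp add: choquet_boundary_def)
    obtain x c where x: "x \<in> topspace X1" and
      xc: "\<And>a. a \<in> A \<Longrightarrow> S a z * of_real (f2 z) = c * (a x * of_real (f1 x))"
      using S_at_choquet_point[OF \<open>z \<in> choquet_boundary X2 E2\<close>] by blast
    have *: "S a z = c * (a x * of_real (f1 x)) / of_real (f2 z)" if "a \<in> A" for a
      using xc[OF that] f2_nonzero[OF z] by (simp add: field_simps)
    show ?thesis
      using z x ab *[OF ab(1)] *[OF ab(2)] *[OF A_closed(2)[OF ab]] *[OF A_closed(4)]
      by (simp add: weighted_def fadd_def fmult_def fscale_def h_def fconst_def)
  qed
  then have "weighted X2 f2 ?k y = 0"
    using choquet_boundary_determines[OF X2 E2_space k _ y] by blast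
  then show ?thesis
    using y f2_nonzero[OF y] by (simp add: weighted_def fadd_def fmult_def fscale_def)
qed

lemma h_inverse:
  obtains k where "k \<in> B" "fmult X2 h k = one2"
proof -
  obtain g where g: "g \<in> A" "S g = one2" using S_onto[OF B_closed(4)] by blast
  have "fmult X2 h (S (fmult X1 g g)) = one2"
    using S_mult[OF g(1) g(1)] g(2) by (auto simp: fmult_def fconst_def fun_eq_iff mult.commute)
  then show ?thesis using that S_weighted(1) A_closed(2) g(1) by blast
qed

lemma h_in_B: "h \<in> B"
  by (simp add: h_def S_weighted(1) A_closed)

lemma h_invertible: "invertible_in X2 B h"
proof -
  obtain k where "k \<in> B" "fmult X2 h k = one2" using h_inverse .
  then show ?thesis using h_in_B unfolding invertible_in_def by blast
qed

lemma h_nonzero: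
  assumes "y \<in> topspace X2"
  shows "h y \<noteq> 0"
proof -
  obtain k where "fmult X2 h k = one2" using h_inverse .
  from fun_cong[OF this, of y] show ?thesis using assms by (auto simp: fmult_def fconst_def)
qed

section \<open>The algebra isomorphism\<close>

definition U :: "('a \<Rightarrow> complex) \<Rightarrow> 'b \<Rightarrow> complex" where
  "U a = (\<lambda>y\<in>topspace X2. S a y / h y)"

text \<open>The pointwise quotient stays in \<open>B\<close> because it is the product with the
  inverse of \<open>h\<close> in \<open>B\<close>.\<close>

lemma U_in_B: "a \<in> A \<Longrightarrow> U a \<in> B"
proof -
  assume a: "a \<in> A"
  obtain k where k: "k \<in> B" "fmult X2 h k = one2" using h_inverse .
  have "h y * k y = 1" if "y \<in> topspace X2" for y
    using fun_cong[OF k(2), of y] that by (simp add: fmult_def fconst_def)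
  then have "U a = fmult X2 (S a) k"
    using h_nonzero by (auto simp: U_def fmult_def fun_eq_iff field_simps)
  then show ?thesis using k(1) a B_closed S_weighted(1) by simp
qed

lemma U_cfuns: "a \<in> A \<Longrightarrow> U a \<in> cfuns X2"
  by (rule B_closed(5)[OF U_in_B])

lemma T_eq: "a \<in> A \<Longrightarrow> y \<in> topspace X2 \<Longrightarrow> T (weighted X1 f1 a) y = U a y * h y * of_real (f2 y)"
  using h_nonzero S_weighted(2) by (simp add: U_def)

lemma U_pointwise:
  assumes "y \<in> topspace X2"
  shows "a \<in> A \<Longrightarrow> b \<in> A \<Longrightarrow> U (fadd X1 a b) y = U a y + U b y"
    and "a \<in> A \<Longrightarrow> b \<in> A \<Longrightarrow> U (fmult X1 a b) y = U a y * U b y"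
    and "a \<in> A \<Longrightarrow> U (fscale X1 c a) y = c * U a y"
    and "U one1 y = 1"
proof -
  note h = h_nonzero[OF assms]
  show "U (fadd X1 a b) y = U a y + U b y" if "a \<in> A" "b \<in> A"
    using assms S_linear(1)[OF assms that] by (simp add: U_def add_divide_distrib)
  show "U (fmult X1 a b) y = U a y * U b y" if "a \<in> A" "b \<in> A"
  proof -
    have "S (fmult X1 a b) y = S a y * S b y / h y"
      using S_mult[OF that assms] h by (simp add: eq_divide_eq)
    then show ?thesis using assms by (simp add: U_def)
  qed
  show "U (fscale X1 c a) y = c * U a y" if "a \<in> A"
    using assms S_linear(2)[OF assms that that] by (simp add: U_def)
  show "U one1 y = 1"
    using assms h by (simp add: U_def flip: h_def)
qed

lemma U_onto: "U ` A = B"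
proof
  show "U ` A \<subseteq> B" using U_in_B by blast
  show "B \<subseteq> U ` A"
  proof
    fix b assume b: "b \<in> B"
    then obtain a where a: "a \<in> A" "S a = fmult X2 b h"
      using S_onto[OF B_closed(2)[OF b h_in_B]] by blast
    have "b = U a"
      using b U_in_B[OF a(1)] h_nonzero by (intro B_eqI) (auto simp: U_def a(2) fmult_def)
    then show "b \<in> U ` A" using a(1) by blast
  qed
qed

lemma norm_h_f2_continuous: "continuous_map X2 euclideanreal (\<lambda>y. norm (h y) * f2 y)"
proof (rule continuous_map_real_mult)
  show "continuous_map X2 euclideanreal (\<lambda>y. norm (h y))"
    using B_closed(5)[OF h_in_B] by (simp add: cfuns_def continuous_map_norm)
  show "continuous_map X2 euclideanreal f2" by (rule f2(1))
qed

text \<open>The modulus of \<open>T (weighted X1 f1 a)\<close> is that of \<open>U a\<close> times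
  \<open>norm h * f2\<close>, and its sup norm is that of \<open>a\<close> times \<open>f1\<close>.
  Both weights are positive and continuous on compact spaces, hence bounded above and away from
  zero.\<close>

lemma U_bounded:
  "\<exists>C>0. (\<forall>a\<in>A. \<forall>y\<in>topspace X2. norm (U a y) \<le> C * supnorm X1 a) \<and>
     (\<forall>a\<in>A. \<forall>x\<in>topspace X1. norm (a x) \<le> C * supnorm X2 (U a))"
proof -
  obtain C1 where C1: "0 < C1" "\<And>x. x \<in> topspace X1 \<Longrightarrow> f1 x \<le> C1" "\<And>x. x \<in> topspace X1 \<Longrightarrow> 1 \<le> C1 * f1 x"
    using positive_continuous_bounds[OF X1 f1] by blast
  have "\<forall>y\<in>topspace X2. 0 < norm (h y) * f2 y"
    using h_nonzero f2(2) by simp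
  then obtain C2 where C2: "0 < C2" "\<And>y. y \<in> topspace X2 \<Longrightarrow> norm (h y) * f2 y \<le> C2"
    "\<And>y. y \<in> topspace X2 \<Longrightarrow> 1 \<le> C2 * (norm (h y) * f2 y)"
    using positive_continuous_bounds[OF X2 norm_h_f2_continuous] by blast
  have T_cfuns: "T (weighted X1 f1 a) \<in> cfuns X2" if "a \<in> A" for a
    using T weighted_E1[OF that] linear_space_cfuns[OF E2_space(1)] by (auto simp: linear_isometry_onto_def)
  have W_cfuns: "weighted X1 f1 a \<in> cfuns X1" if "a \<in> A" for a
    using weighted_E1[OF that] linear_space_cfuns[OF E1_space(1)] by simp
  have T_norm: "supnorm X2 (T (weighted X1 f1 a)) = supnorm X1 (weighted X1 f1 a)" if "a \<in> A" for a
    using T weighted_E1[OF that] by (simp add: linear_isometry_onto_def)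
  have T_val: "norm (T (weighted X1 f1 a) y) = norm (U a y) * (norm (h y) * f2 y)"
    if "a \<in> A" "y \<in> topspace X2" for a y
    using T_eq[OF that] bspec[OF f2(2) that(2)] by (simp add: norm_mult)
  have W_val: "norm (weighted X1 f1 a x) = norm (a x) * f1 x" if "x \<in> topspace X1" for a x
    using bspec[OF f1(2) that] that by (simp add: weighted_def norm_mult)
  have grow: "r \<le> C * (r * q)" if "1 \<le> C * q" "0 \<le> r" for r C q :: real
    using mult_left_mono[OF that] by (simp add: mult_ac)
  show ?thesis
  \<comment> \<open>Each of the two estimates uses the upper bound of one weight and the lower bound
    of the other, so the same product serves both.\<close>
  proof (intro exI[of _ "C1 * C2"] conjI ballI)
    show "0 < C1 * C2" using C1 C2 by simp
    show "norm (U a y) \<le> C1 * C2 * supnorm X1 a" if a: "a \<in> A" and y: "y \<in> topspace X2" for a y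
    proof -
      have "supnorm X1 (weighted X1 f1 a) \<le> supnorm X1 a * C1"
      proof (rule supnorm_le[OF X1 W_cfuns[OF a]])
        show "0 \<le> supnorm X1 a * C1" using supnorm_nonneg[OF X1 A_closed(5)[OF a]] C1(1) by simp
        show "norm (weighted X1 f1 a x) \<le> supnorm X1 a * C1" if "x \<in> topspace X1" for x
          unfolding W_val[OF that]
          using norm_le_supnorm[OF X1 A_closed(5)[OF a] that] C1(2)[OF that] f1(2) that
          by (intro mult_mono) (auto intro: less_imp_le order_trans[OF norm_ge_zero])
      qed
      moreover have "norm (U a y) * (norm (h y) * f2 y) \<le> supnorm X1 (weighted X1 f1 a)"
        using norm_le_supnorm[OF X2 T_cfuns[OF a] y] T_val[OF a y] T_norm[OF a] by simp
      ultimately have "C2 * (norm (U a y) * (norm (h y) * f2 y)) \<le> C2 * (supnorm X1 a * C1)"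
        using C2(1) by simp
      then show ?thesis
        using grow[OF C2(3)[OF y] norm_ge_zero[of "U a y"]] by (simp add: mult_ac)
    qed
    show "norm (a x) \<le> C1 * C2 * supnorm X2 (U a)" if a: "a \<in> A" and x: "x \<in> topspace X1" for a x
    proof -
      note U = U_cfuns[OF a]
      have "supnorm X2 (T (weighted X1 f1 a)) \<le> supnorm X2 (U a) * C2"
      proof (rule supnorm_le[OF X2 T_cfuns[OF a]])
        show "0 \<le> supnorm X2 (U a) * C2" using supnorm_nonneg[OF X2 U] C2(1) by simp
        show "norm (T (weighted X1 f1 a) y) \<le> supnorm X2 (U a) * C2" if "y \<in> topspace X2" for y
          unfolding T_val[OF a that]
          using norm_le_supnorm[OF X2 U that] C2(2)[OF that] f2(2) that
          by (intro mult_mono) (auto intro: less_imp_le order_trans[OF norm_ge_zero])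
      qed
      moreover have "norm (a x) * f1 x \<le> supnorm X2 (T (weighted X1 f1 a))"
        using norm_le_supnorm[OF X1 W_cfuns[OF a] x] W_val[OF x] T_norm[OF a] by simp
      ultimately have "C1 * (norm (a x) * f1 x) \<le> C1 * (supnorm X2 (U a) * C2)"
        using C1(1) by simp
      then show ?thesis
        using grow[OF C1(3)[OF x] norm_ge_zero[of "a x"]] by (simp add: mult_ac)
    qed
  qed
qed

lemma U_powers:
  assumes "a \<in> A"
  shows "\<exists>b\<in>A. (\<forall>x\<in>topspace X1. b x = a x ^ n) \<and> (\<forall>y\<in>topspace X2. U b y = U a y ^ n)"
proof (induction n)
  case 0
  have "one1 x = 1" if "x \<in> topspace X1" for x using that by (simp add: fconst_def)
  then show ?case
    using U_pointwise(4) A_closed(4)[of 1] by (intro bexI[of _ one1]) auto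
next
  case (Suc n)
  then obtain b where "b \<in> A" "\<forall>x\<in>topspace X1. b x = a x ^ n" "\<forall>y\<in>topspace X2. U b y = U a y ^ n"
    by blast
  moreover have "fmult X1 a b x = a x * b x" if "x \<in> topspace X1" for x
    using that by (simp add: fmult_def)
  ultimately show ?case
    using assms U_pointwise(2) A_closed(2) by (intro bexI[of _ "fmult X1 a b"]) auto
qed

lemma U_norm:
  assumes a: "a \<in> A"
  shows "supnorm X2 (U a) = supnorm X1 a"
proof -
  note U = U_cfuns
  note A_cfuns = A_closed(5)
  obtain C where C: "0 < C" "\<And>a y. a \<in> A \<Longrightarrow> y \<in> topspace X2 \<Longrightarrow> norm (U a y) \<le> C * supnorm X1 a"
    "\<And>a x. a \<in> A \<Longrightarrow> x \<in> topspace X1 \<Longrightarrow> norm (a x) \<le> C * supnorm X2 (U a)"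
    using U_bounded by blast
  note nonneg = supnorm_nonneg[OF X1 A_cfuns[OF a]] supnorm_nonneg[OF X2 U[OF a]]
  have "norm (U a y) ^ n \<le> C * supnorm X1 a ^ n" if y: "y \<in> topspace X2" for y n
  proof -
    obtain b where b: "b \<in> A" "\<And>x. x \<in> topspace X1 \<Longrightarrow> b x = a x ^ n"
      "\<And>y. y \<in> topspace X2 \<Longrightarrow> U b y = U a y ^ n"
      using U_powers[OF a] by blast
    have "supnorm X1 b \<le> supnorm X1 a ^ n"
      using b(2) nonneg norm_le_supnorm[OF X1 A_cfuns[OF a]]
      by (intro supnorm_le[OF X1 A_cfuns[OF b(1)]]) (simp_all add: norm_power power_mono)
    then show ?thesis
      using C(2)[OF b(1) y] b(3)[OF y] C(1)
      by (simp add: norm_power) (meson mult_left_mono order.trans less_imp_le)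
  qed
  then have "norm (U a y) \<le> supnorm X1 a" if "y \<in> topspace X2" for y
    using power_bound_imp_le nonneg(1) that by blast
  then have 1: "supnorm X2 (U a) \<le> supnorm X1 a"
    using supnorm_le[OF X2 U[OF a] nonneg(1)] by blast
  have "norm (a x) ^ n \<le> C * supnorm X2 (U a) ^ n" if x: "x \<in> topspace X1" for x n
  proof -
    obtain b where b: "b \<in> A" "\<And>x. x \<in> topspace X1 \<Longrightarrow> b x = a x ^ n"
      "\<And>y. y \<in> topspace X2 \<Longrightarrow> U b y = U a y ^ n"
      using U_powers[OF a] by blast
    have "supnorm X2 (U b) \<le> supnorm X2 (U a) ^ n"
      using b(3) nonneg norm_le_supnorm[OF X2 U[OF a]]
      by (intro supnorm_le[OF X2 U[OF b(1)]]) (simp_all add: norm_power power_mono)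
    then show ?thesis
      using C(3)[OF b(1) x] b(2)[OF x] C(1)
      by (simp add: norm_power) (meson mult_left_mono order.trans less_imp_le)
  qed
  then have "norm (a x) \<le> supnorm X2 (U a)" if "x \<in> topspace X1" for x
    using power_bound_imp_le nonneg(2) that by blast
  then have "supnorm X1 a \<le> supnorm X2 (U a)"
    using supnorm_le[OF X1 A_cfuns[OF a] nonneg(2)] by blast
  with 1 show ?thesis by simp
qed

lemma U_isometry: "linear_isometry_onto X1 A X2 B U"
  unfolding linear_isometry_onto_def
proof (intro conjI ballI allI)
  show "U ` A = B" by (rule U_onto)
  show "U (fadd X1 a b) = fadd X2 (U a) (U b)" if "a \<in> A" "b \<in> A" for a b
    using that U_pointwise(1) by (auto simp: fadd_def[of X2] fun_eq_iff U_def)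
  show "U (fscale X1 c a) = fscale X2 c (U a)" if "a \<in> A" for c a
    using that U_pointwise(3) by (auto simp: fscale_def[of X2] fun_eq_iff U_def)
  show "supnorm X2 (U a) = supnorm X1 a" if "a \<in> A" for a using U_norm[OF that] .
qed

lemma U_inj: "inj_on U A"
  using isometry_inj_on[OF X1 A_space(1) X2 B_space(1) U_isometry] .

lemma U_mult: "a \<in> A \<Longrightarrow> b \<in> A \<Longrightarrow> U (fmult X1 a b) = fmult X2 (U a) (U b)"
  using U_pointwise(2) by (auto simp: fmult_def[of X2] fun_eq_iff U_def)

section \<open>The induced map into the maximal ideal space and the boundaries\<close>

definition \<phi> :: "'b \<Rightarrow> ('a \<Rightarrow> complex) \<Rightarrow> complex" where
  "\<phi> y = (\<lambda>a\<in>A. U a y)"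

lemma phi_character: "y \<in> topspace X2 \<Longrightarrow> (\<lambda>a\<in>A. U a y) \<in> characters X1 A"
  unfolding characters_def linear_functional_on_def
  using U_pointwise A_closed by (auto intro!: bexI[of _ one1])

lemma phi_continuous: "continuous_map X2 (maximal_ideal_space X1 A) \<phi>"
  unfolding \<phi>_def[abs_def] by (rule continuous_map_character_map[OF U_cfuns phi_character])

lemma phi_closed: "closed_map X2 (maximal_ideal_space X1 A) \<phi>"
  unfolding \<phi>_def[abs_def] by (rule character_map_closed[OF X2 U_cfuns phi_character])

lemma phi_embedding: "embedding_map X2 (maximal_ideal_space X1 A) \<phi>"
  unfolding \<phi>_def[abs_def]
proof (rule character_map_embedding[OF X2 U_cfuns phi_character])
  \<comment> \<open>\<open>B\<close> separates points, and each of its elements is some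
    \<open>U a\<close>.\<close>
  show "\<exists>a\<in>A. U a y \<noteq> U a z" if "y \<in> topspace X2" "z \<in> topspace X2" "y \<noteq> z" for y z
    using B that U_onto unfolding uniform_algebra_def by (metis imageE)
qed

lemma compose_phi: "a \<in> A \<Longrightarrow> compose (topspace X2) (gelfand a) \<phi> = U a"
  by (auto simp: compose_def gelfand_def \<phi>_def U_def)

lemma phi_algebra_iso: "isometric_algebra_iso X1 A X2 B (\<lambda>a. compose (topspace X2) (gelfand a) \<phi>)"
proof -
  have "bij_betw (\<lambda>a. compose (topspace X2) (gelfand a) \<phi>) A B \<longleftrightarrow> bij_betw U A B"
    by (intro bij_betw_cong compose_phi)
  moreover have "bij_betw U A B" using U_inj U_onto by (simp add: bij_betw_def)
  moreover have "linear_isometry_onto X1 A X2 B (\<lambda>a. compose (topspace X2) (gelfand a) \<phi>)"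
    using U_isometry compose_phi A_closed by (simp add: linear_isometry_onto_def)
  ultimately show ?thesis
    using U_mult compose_phi A_closed by (simp add: isometric_algebra_iso_def)
qed

text \<open>Extreme points are now compared under \<open>U\<close> and under its inverse, one for
  each inclusion. The unimodular factor is 1 since \<open>U\<close> takes the constant 1 to the
  constant 1.\<close>

lemma phi_choquet: "\<phi> ` choquet_boundary X2 B = point_eval A ` choquet_boundary X1 A"
proof (intro equalityI subsetI)
  fix m assume "m \<in> \<phi> ` choquet_boundary X2 B"
  then obtain y where y: "m = \<phi> y" "y \<in> choquet_boundary X2 B" by blast
  obtain x c where x: "x \<in> choquet_boundary X1 A" "\<And>a. a \<in> A \<Longrightarrow> U a y = c * a x"
    using isometry_at_choquet_point[OF X1 A_space X2 B_space U_isometry y(2)] by blast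
  have "c = 1"
    using x(2)[OF A_closed(4)[of 1]] U_pointwise(4)[of y] x(1) y(2)
    by (simp add: fconst_def choquet_boundary_def)
  then have "\<phi> y = point_eval A x" using x(2) by (auto simp: \<phi>_def point_eval_def)
  then show "m \<in> point_eval A ` choquet_boundary X1 A" using x(1) y(1) by blast
next
  fix m assume "m \<in> point_eval A ` choquet_boundary X1 A"
  then obtain x where x: "m = point_eval A x" "x \<in> choquet_boundary X1 A" by blast
  have V: "linear_isometry_onto X2 B X1 A (inv_into A U)"
    using isometry_inverse[OF X1 A_space(1) X2 B_space(1) U_isometry] .
  obtain y c where y: "y \<in> choquet_boundary X2 B" "\<And>b. b \<in> B \<Longrightarrow> inv_into A U b x = c * b y"
    using isometry_at_choquet_point[OF X2 B_space X1 A_space V x(2)] by blast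
  have inv: "a x = c * U a y" if "a \<in> A" for a
    using y(2)[OF U_in_B[OF that]] U_inj that by simp
  have "c = 1"
    using inv[OF A_closed(4)[of 1]] U_pointwise(4)[of y] x(2) y(1)
    by (simp add: fconst_def choquet_boundary_def)
  then have "\<phi> y = point_eval A x" using inv by (auto simp: \<phi>_def point_eval_def)
  then show "m \<in> \<phi> ` choquet_boundary X2 B" using y(1) x(1) by (metis imageI)
qed

lemma phi_shilov: "\<phi> ` shilov_boundary X2 B = point_eval A ` shilov_boundary X1 A"
proof -
  have "choquet_boundary X2 B \<subseteq> topspace X2" "choquet_boundary X1 A \<subseteq> topspace X1"
    by (auto simp: choquet_boundary_def)
  then show ?thesis
    unfolding shilov_boundary_def
    using phi_choquet point_eval_map[OF X1 A] phi_continuous phi_closed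
    by (simp add: continuous_closed_map_image_closure_of)
qed

text \<open>For the constant function 1 the boundary formula reads
  \<open>h y * f2 y = c * f1 x\<close>. Dividing the general formula by this one leaves
  \<open>U a y = a x\<close>, and taking moduli in it leaves the relation between the weights;
  \<open>c\<close> disappears both times.\<close>

lemma phi_at_choquet_point:
  assumes "y \<in> choquet_boundary X2 E2"
  obtains x where "x \<in> topspace X1" "\<phi> y = point_eval A x" "f1 x = norm (h y) * f2 y"
proof -
  have y: "y \<in> topspace X2" using assms by (simp add: choquet_boundary_def)
  obtain x c where x: "x \<in> topspace X1" "norm c = 1"
    "\<And>a. a \<in> A \<Longrightarrow> S a y * of_real (f2 y) = c * (a x * of_real (f1 x))"
    using S_at_choquet_point[OF assms] by blast
  have h: "h y * of_real (f2 y) = c * of_real (f1 x)"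
    using x(3)[OF A_closed(4)[of 1]] x(1) by (simp add: h_def fconst_def)
  have pos: "f1 x > 0" "f2 y > 0" using f1(2) f2(2) x(1) y by auto
  have "U a y = a x" if "a \<in> A" for a
  proof -
    have "S a y * of_real (f2 y) = a x * h y * of_real (f2 y)"
      using x(3)[OF that] h by (simp add: mult_ac)
    then show ?thesis using pos h_nonzero[OF y] y by (simp add: U_def)
  qed
  then have "\<phi> y = point_eval A x" by (auto simp: \<phi>_def point_eval_def)
  moreover have "norm (h y) * f2 y = f1 x"
    using arg_cong[OF h, of norm] x(2) pos by (simp add: norm_mult)
  ultimately show ?thesis using that x(1) by simp
qed

text \<open>The evaluations at points of \<open>X1\<close> form a closed subset of the maximal ideal
  space, so containment passes from the Choquet boundary to its closure.\<close>

lemma phi_shilov_weighted: "\<phi> ` shilov_boundary X2 E2 \<subseteq> point_eval A ` topspace X1"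
proof -
  let ?M = "maximal_ideal_space X1 A"
  have "closedin ?M (point_eval A ` topspace X1)"
    using point_eval_map(3)[OF X1 A] by (simp add: closed_map_def)
  moreover have "\<phi> ` choquet_boundary X2 E2 \<subseteq> point_eval A ` topspace X1"
    using phi_at_choquet_point by blast
  moreover have "\<phi> ` (X2 closure_of choquet_boundary X2 E2) \<subseteq> ?M closure_of (\<phi> ` choquet_boundary X2 E2)"
    using phi_continuous by (rule continuous_map_image_closure_subset)
  ultimately show ?thesis
    unfolding shilov_boundary_def using closure_of_minimal by blast
qed

text \<open>The relation between the weights holds on the Choquet boundary and has to survive
  passage to the closure. For this \<open>f1\<close> must become a continuous function of
  \<open>\<phi> y\<close>, which the inverse \<open>p\<close> of the embedding of \<open>X1\<close>
  provides.\<close>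

lemma norm_h_on_shilov:
  assumes y: "y \<in> shilov_boundary X2 E2" and x: "x \<in> topspace X1" "\<phi> y = point_eval A x"
  shows "f1 x / f2 y = norm (h y)"
proof -
  let ?M = "maximal_ideal_space X1 A"
  let ?P = "point_eval A ` topspace X1"
  let ?K = "shilov_boundary X2 E2"
  have K: "closedin X2 ?K" by (simp add: shilov_boundary_def)
  then have Ksub: "?K \<subseteq> topspace X2" by (rule closedin_subset)
  obtain p where p: "homeomorphic_maps X1 (subtopology ?M ?P) (point_eval A) p"
    using point_eval_map(1)[OF X1 A] unfolding embedding_map_def homeomorphic_map_maps by blast
  then have p_inv: "p (point_eval A z) = z" if "z \<in> topspace X1" for z
    using that by (simp add: homeomorphic_maps_def)
  have "continuous_map (subtopology X2 ?K) (subtopology ?M ?P) \<phi>"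
    using phi_continuous phi_shilov_weighted
    by (auto simp: continuous_map_in_subtopology intro: continuous_map_from_subtopology)
  moreover have "continuous_map (subtopology ?M ?P) X1 p"
    using p by (simp add: homeomorphic_maps_def)
  ultimately have "continuous_map (subtopology X2 ?K) X1 (p \<circ> \<phi>)"
    by (rule continuous_map_compose)
  from continuous_map_compose[OF this f1(1)]
  have c1: "continuous_map (subtopology X2 ?K) euclideanreal (\<lambda>y. f1 (p (\<phi> y)))"
    by (simp add: o_def)
  have c2: "continuous_map (subtopology X2 ?K) euclideanreal (\<lambda>y. norm (h y) * f2 y)"
    by (rule continuous_map_from_subtopology[OF norm_h_f2_continuous])
  let ?Z = "{y \<in> topspace (subtopology X2 ?K). f1 (p (\<phi> y)) - norm (h y) * f2 y \<in> {0}}"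
  have "closedin (subtopology X2 ?K) ?Z"
    by (rule closedin_continuous_map_preimage[OF continuous_map_diff[OF c1 c2]]) simp
  then have "closedin X2 ?Z" using K closedin_trans_full by blast
  moreover have "choquet_boundary X2 E2 \<subseteq> ?Z"
  proof
    fix z assume z: "z \<in> choquet_boundary X2 E2"
    then obtain w where "w \<in> topspace X1" "\<phi> z = point_eval A w" "f1 w = norm (h z) * f2 z"
      using phi_at_choquet_point by blast
    moreover have "z \<in> topspace X2" "z \<in> ?K"
      using z closure_of_subset[of "choquet_boundary X2 E2" X2]
      by (auto simp: choquet_boundary_def shilov_boundary_def)
    ultimately show "z \<in> ?Z" using p_inv by simp
  qed
  ultimately have "?K \<subseteq> ?Z"
    by (subst shilov_boundary_def) (rule closure_of_minimal)
  then have "f1 x = norm (h y) * f2 y" using y x p_inv by auto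
  moreover have "f2 y \<noteq> 0" using f2_nonzero y Ksub by blast
  ultimately show ?thesis by simp
qed

end

text \<open>Testing the module identity on \<open>f1\<close> alone gives
  \<open>U a * h * f2 = a * h * f2\<close>, where \<open>h\<close> and \<open>f2\<close> have no
  zeros. Conversely \<open>T\<close> takes \<open>a * b * f1\<close> to
  \<open>U a * U b * h * f2\<close>, in which \<open>U a\<close> may be replaced by
  \<open>a\<close>.\<close>

lemma module_isometry_iff_phi_eq_point_eval:
  fixes X :: "'a topology"
  assumes "weighted_isometry X X A A f1 f2 T"
  shows "module_isometry_onto X A (weighted_space X A f1) (weighted_space X A f2) T \<longleftrightarrow>
    (\<forall>x\<in>topspace X. weighted_isometry.\<phi> X X A f1 f2 T x = point_eval A x)"
proof -
  interpret weighted_isometry X X A A f1 f2 T by fact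
  have eq_iff: "(\<forall>x\<in>topspace X. \<phi> x = point_eval A x) \<longleftrightarrow> (\<forall>x\<in>topspace X. \<forall>a\<in>A. U a x = a x)"
    by (auto simp: \<phi>_def point_eval_def fun_eq_iff)
  have fmult_weighted: "fmult X a (weighted X f1 b) = weighted X f1 (fmult X a b)" for a b
    by (auto simp: fmult_def weighted_def fun_eq_iff)
  have T_val: "T (fmult X a (weighted X f1 b)) x = U a x * U b x * h x * of_real (f2 x)"
    if "a \<in> A" "b \<in> A" "x \<in> topspace X" for a b x
    using that T_eq A_closed(2) U_pointwise(2) by (simp add: fmult_weighted)
  show ?thesis
    unfolding eq_iff
  proof
    assume M: "module_isometry_onto X A E1 E2 T"
    show "\<forall>x\<in>topspace X. \<forall>a\<in>A. U a x = a x"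
    proof (intro ballI)
      fix x a assume x: "x \<in> topspace X" and a: "a \<in> A"
      have "T (fmult X a (weighted X f1 one1)) = fmult X a (T (weighted X f1 one1))"
        using M a weighted_E1[OF A_closed(4)] by (simp add: module_isometry_onto_def)
      then have "T (fmult X a (weighted X f1 one1)) x = a x * T (weighted X f1 one1) x"
        using x by (simp add: fmult_def[of X a "T (weighted X f1 one1)"])
      then have "U a x * U one1 x * h x * of_real (f2 x) = a x * (U one1 x * h x * of_real (f2 x))"
        unfolding T_val[OF a A_closed(4) x] T_eq[OF A_closed(4) x] .
      then show "U a x = a x"
        using U_pointwise(4)[OF x] h_nonzero[OF x] f2_nonzero[OF x] by simp
    qed
  next
    assume U: "\<forall>x\<in>topspace X. \<forall>a\<in>A. U a x = a x"
    have "T (fmult X a g) = fmult X a (T g)" if a: "a \<in> A" and "g \<in> E1" for a g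
    proof -
      obtain b where b: "b \<in> A" "g = weighted X f1 b" using \<open>g \<in> E1\<close> by (auto simp: weighted_space_def)
      have "T (fmult X a g) \<in> E2"
        using T weighted_E1[OF A_closed(2)[OF a b(1)]]
        by (auto simp: linear_isometry_onto_def b(2) fmult_weighted)
      then have "T (fmult X a g) \<in> extensional (topspace X)"
        using linear_space_cfuns[OF E2_space(1)] by (auto simp: cfuns_def)
      moreover have "T (fmult X a g) x = fmult X a (T g) x" if "x \<in> topspace X" for x
        using T_val[OF a b(1) that] T_eq[OF b(1) that] U that a by (simp add: b(2) fmult_def)
      ultimately show ?thesis
        by (intro extensionalityI[of _ "topspace X"]) (auto simp: fmult_def)
    qed
    then show "module_isometry_onto X A E1 E2 T"
      using T by (simp add: module_isometry_onto_def)
  qed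
qed

theorem theorem3p4:
  fixes X1 X2 :: "'a topology"
    and A B :: "('a \<Rightarrow> complex) set"
    and f1 f2 :: "'a \<Rightarrow> real"
    and T :: "('a \<Rightarrow> complex) \<Rightarrow> 'a \<Rightarrow> complex"
  assumes "compact_space X1" and "Hausdorff_space X1"
    and "compact_space X2" and "Hausdorff_space X2"
    and "uniform_algebra X1 A" and "uniform_algebra X2 B"
    and "continuous_map X1 euclideanreal f1" and "\<forall>x\<in>topspace X1. 0 < f1 x"
    and "continuous_map X2 euclideanreal f2" and "\<forall>y\<in>topspace X2. 0 < f2 y"
    and "linear_isometry_onto X1 (weighted_space X1 A f1) X2 (weighted_space X2 B f2) T"
  shows "\<exists>h \<phi>.
    invertible_in X2 B h \<and>
    embedding_map X2 (maximal_ideal_space X1 A) \<phi> \<and>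
    isometric_algebra_iso X1 A X2 B (\<lambda>a. compose (topspace X2) (gelfand a) \<phi>) \<and>
    \<phi> ` shilov_boundary X2 B = point_eval A ` shilov_boundary X1 A \<and>
    \<phi> ` shilov_boundary X2 (weighted_space X2 B f2) \<subseteq> point_eval A ` topspace X1 \<and>
    (\<forall>y\<in>shilov_boundary X2 (weighted_space X2 B f2). \<forall>x\<in>topspace X1.
       \<phi> y = point_eval A x \<longrightarrow> f1 x / f2 y = norm (h y)) \<and>
    (\<forall>a\<in>A. \<forall>y\<in>topspace X2.
       T (weighted X1 f1 a) y = gelfand a (\<phi> y) * h y * of_real (f2 y)) \<and>
    (X1 = X2 \<and> A = B \<longrightarrow>
       (module_isometry_onto X1 A (weighted_space X1 A f1) (weighted_space X2 B f2) T
        \<longleftrightarrow> (\<forall>x\<in>topspace X2. \<phi> x = point_eval A x)))"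
proof -
  interpret weighted_isometry X1 X2 A B f1 f2 T
    by unfold_locales (fact assms)+
  have T_gelfand: "T (weighted X1 f1 a) y = gelfand a (\<phi> y) * h y * of_real (f2 y)"
    if "a \<in> A" "y \<in> topspace X2" for a y
    using T_eq[OF that] that by (simp add: gelfand_def \<phi>_def)
  have "module_isometry_onto X1 A E1 E2 T \<longleftrightarrow> (\<forall>x\<in>topspace X2. \<phi> x = point_eval A x)"
    if "X1 = X2" "A = B"
    using module_isometry_iff_phi_eq_point_eval[of X1 A f1 f2 T] weighted_isometry_axioms that by simp
  then show ?thesis
    using h_invertible phi_embedding phi_algebra_iso phi_shilov phi_shilov_weighted
      norm_h_on_shilov T_gelfand
    by (intro exI[of _ h] exI[of _ \<phi>]) blast
qed

end
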